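(* Let $m$ be a positive integer and $k$ a nonnegative integer. The number of self-conjugate $(2m+1, 2m+2, \ldots, 2m+2k+2)$-core partitions is equal to the number of symmetric $(2m+1,2k+1)$-Dyck paths.
   Context: A partition $\lambda$ is identified with its Young diagram; its conjugate is the reflection of the diagram in the main diagonal, and $\lambda$ is self-conjugate if it equals its conjugate. The hook length of a box is the number of boxes weakly to its right in its row plus those strictly below it in its column. For a positive integer $t$, $\lambda$ is a $t$-core if no box has hook length divisible by $t$; it is a $(t_1,\ldots,t_r)$-core if it is a $t_i$-core for every $i$. For a positive integer $k$ and $s>0$, an $(s,k)$-Dyck path is a lattice path from $(0,0)$ to $(s,0)$ using up steps $(k/2,1)$, down steps $(k/2,-1)$ and horizontal steps $(\ell,0)$ with $\ell$ an integer, $1\le\ell<k$, never going below the $x$-axis. It is symmetric if its reflection about the line $x=s/2$ is itself. *)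

theory Defs
  imports Complex_Main "HOL-Library.Product_Plus"
begin

text \<open>
  A partition is the list of its parts. Boxes of the Young diagram are pairs (row, column),
  both counted from 0, with row 0 on top.
\<close>

definition is_partition :: "nat list \<Rightarrow> bool" where
  "is_partition \<mu> \<longleftrightarrow> sorted_wrt (\<ge>) \<mu> \<and> 0 \<notin> set \<mu>"

definition young_diagram :: "nat list \<Rightarrow> (nat \<times> nat) set" where
  "young_diagram \<mu> = {(i, j). i < length \<mu> \<and> j < \<mu> ! i}"

definition conjugate_diagram :: "(nat \<times> nat) set \<Rightarrow> (nat \<times> nat) set" where
  "conjugate_diagram D = prod.swap ` D"

definition self_conjugate :: "nat list \<Rightarrow> bool" where
  "self_conjugate \<mu> \<longleftrightarrow> conjugate_diagram (young_diagram \<mu>) = young_diagram \<mu>"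

definition hook_length :: "nat list \<Rightarrow> nat \<Rightarrow> nat \<Rightarrow> nat" where
  "hook_length \<mu> i j =
     card {j'. j \<le> j' \<and> (i, j') \<in> young_diagram \<mu>} +
     card {i'. i < i' \<and> (i', j) \<in> young_diagram \<mu>}"

definition is_core :: "nat \<Rightarrow> nat list \<Rightarrow> bool" where
  "is_core t \<mu> \<longleftrightarrow> (\<forall>(i, j) \<in> young_diagram \<mu>. \<not> t dvd hook_length \<mu> i j)"

definition self_conjugate_cores :: "nat set \<Rightarrow> nat list set" where
  "self_conjugate_cores T =
     {\<mu>. is_partition \<mu> \<and> self_conjugate \<mu> \<and> (\<forall>t \<in> T. is_core t \<mu>)}"

definition dyck_steps :: "nat \<Rightarrow> (real \<times> real) set" where
  "dyck_steps k =
     {(real k / 2, 1), (real k / 2, -1)} \<union> {(real l, 0) | l :: nat. 1 \<le> l \<and> l < k}"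

text \<open>
  A lattice path is the list of its vertices. Since the steps in \<^term>\<open>dyck_steps k\<close> are
  pairwise distinct vectors, this is the same as its sequence of steps; in particular, two
  consecutive horizontal steps differ from one horizontal step of the same total length.
  As steps are straight segments, staying weakly above the x-axis is a condition on the vertices.
\<close>

definition dyck_path :: "nat \<Rightarrow> nat \<Rightarrow> (real \<times> real) list \<Rightarrow> bool" where
  "dyck_path s k p \<longleftrightarrow>
     p \<noteq> [] \<and> hd p = (0, 0) \<and> last p = (real s, 0) \<and>
     successively (\<lambda>P Q. Q - P \<in> dyck_steps k) p \<and>
     (\<forall>(x, y) \<in> set p. 0 \<le> y)"

text \<open>
  The reflection about the line x = s/2, with the vertices listed from left to right again.
\<close>

definition reflect_path :: "nat \<Rightarrow> (real \<times> real) list \<Rightarrow> (real \<times> real) list" where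
  "reflect_path s p = rev (map (\<lambda>(x, y). (real s - x, y)) p)"

definition symmetric_dyck_paths :: "nat \<Rightarrow> nat \<Rightarrow> (real \<times> real) list set" where
  "symmetric_dyck_paths s k = {p. dyck_path s k p \<and> reflect_path s p = p}"

end

theory Submission
  imports Defs
begin

text \<open>Encode a self-conjugate partition by the set S of all \<mu> ! i - i - 1, with \<mu> continued by zeros. It contains
  exactly one of n and -1-n, and the partition is a t-core iff S is closed under subtraction of t. With s = 2m+1, let
  Q r be the largest q with s q + r in S. Closure under subtraction of s, ..., s+2k+1 means that Q
  increases by at most 1 over distances up to 2k+1, and by symmetry Q is determined by its values
  on 0, ..., m. Cutting such a function at the first place where it does not exceed its initial
  value turns it into a walk with the (2k+1)-Dyck steps, without positivity condition.

  A symmetric Dyck path is determined by its left half, a nonnegative path with free final height.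
  As for simple random walks, these are equinumerous with the unrestricted walks of net height 0 or -1.
  The two resulting sums of numbers of walks agree because of the first-step recursion.\<close>

subsection \<open>Self-conjugate cores and symmetric bead sets\<close>

text \<open>The Dyck steps come from a shear. Put K = 2k+1 and let c be the number of columns left
  in a profile and q its current value. Lowering q uses no column, while a rise by 1 is settled only
  after a full window of K columns; measured by the width c + K q / 2, a drop and a rise both cost
  K/2, and a cut after l columns at unchanged value costs l. A flat step of length K would be a rise
  followed by a drop, so flat steps stay shorter than K. To make this reading exact, profiles are
  counted with initial value at most q rather than equal to q: passing from q to q - 1 is then
  itself a step. The exact initial value 0 enters as a difference of two such counts. The centre of
  symmetry leaves over profiles that end in an uncut plateau, of length between k + 1 and 2k. In the
  final difference their contribution for q = -1 cancels, and that for q = 0 supplies the count of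
  the Dyck paths whose central gap l is even and less than 2k.\<close>

definition part :: "nat list \<Rightarrow> nat \<Rightarrow> nat" where
  "part \<mu> i = (if i < length \<mu> then \<mu> ! i else 0)"

text \<open>For a self-conjugate partition this set contains exactly one of n and -1-n, and the hook lengths
  are the positive values of x + y + 1 for x and y in the set.\<close>

definition beads :: "nat list \<Rightarrow> int set" where
  "beads \<mu> = range (\<lambda>i. int (part \<mu> i) - int i - 1)"

definition symmetric_bead_sets :: "nat set \<Rightarrow> int set set" where
  "symmetric_bead_sets T =
     {S. (\<forall>n. n \<in> S \<longleftrightarrow> -1 - n \<notin> S) \<and> (\<forall>t\<in>T. \<forall>n\<in>S. n - int t \<in> S)}"

lemma young_diagram_iff: "(i, j) \<in> young_diagram \<mu> \<longleftrightarrow> j < part \<mu> i"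
  by (auto simp: young_diagram_def part_def)

lemma self_conjugate_iff: "self_conjugate \<mu> \<longleftrightarrow> (\<forall>i j. j < part \<mu> i \<longleftrightarrow> i < part \<mu> j)"
proof -
  have "conjugate_diagram (young_diagram \<mu>) = {(i, j). (j, i) \<in> young_diagram \<mu>}"
    by (force simp: conjugate_diagram_def)
  then have "self_conjugate \<mu> \<longleftrightarrow>
      (\<forall>i j. (i, j) \<in> young_diagram \<mu> \<longleftrightarrow> (j, i) \<in> young_diagram \<mu>)"
    by (auto simp: self_conjugate_def set_eq_iff)
  then show ?thesis by (simp add: young_diagram_iff)
qed

lemma part_antimono: "is_partition \<mu> \<Longrightarrow> i \<le> j \<Longrightarrow> part \<mu> j \<le> part \<mu> i"
  by (cases "i = j") (auto simp: is_partition_def part_def sorted_wrt_iff_nth_less)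

lemma partition_eqI:
  assumes "is_partition \<mu>" "is_partition \<nu>" and eq: "part \<mu> = part \<nu>"
  shows "\<mu> = \<nu>"
proof -
  have len: "i < length \<mu> \<longleftrightarrow> 0 < part \<mu> i" if "is_partition \<mu>" for \<mu> i
    using that by (auto simp: is_partition_def part_def) (metis gr0I nth_mem)
  have "i < length \<mu> \<longleftrightarrow> i < length \<nu>" for i
    using len assms by simp
  then have "length \<mu> = length \<nu>"
    by (meson linorder_neqE_nat less_irrefl)
  then show ?thesis
  proof (rule nth_equalityI)
    fix i assume "i < length \<mu>"
    then show "\<mu> ! i = \<nu> ! i"
      using fun_cong[OF eq, of i] \<open>length \<mu> = length \<nu>\<close> by (simp add: part_def)
  qed
qed

text \<open>Column j is as long as row j, so the two counts are \<open>part \<mu> i - j\<close> and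
  \<open>part \<mu> j - i - 1\<close>. Hooks thereby become sums of two beads.\<close>

lemma hook_length_self_conjugate:
  assumes "self_conjugate \<mu>" "j < part \<mu> i"
  shows "int (hook_length \<mu> i j) = (int (part \<mu> i) - int i - 1) + (int (part \<mu> j) - int j - 1) + 1"
proof -
  have ij: "i < part \<mu> j" using assms by (simp add: self_conjugate_iff)
  have "{j'. j \<le> j' \<and> (i, j') \<in> young_diagram \<mu>} = {j..<part \<mu> i}"
    by (auto simp: young_diagram_iff)
  moreover have "{i'. i < i' \<and> (i', j) \<in> young_diagram \<mu>} = {i<..<part \<mu> j}"
    using assms by (auto simp: young_diagram_iff self_conjugate_iff)
  ultimately show ?thesis
    using assms ij by (simp add: hook_length_def of_nat_diff)
qed

text \<open>Two beads never add up to -1, because \<open>part \<mu> i - j\<close> and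
  \<open>part \<mu> j - i\<close> are both positive or both nonpositive. Conversely, a value skipped
  by the rows is met, after reflection, by a column, and columns are rows.\<close>

lemma beads_symmetric:
  assumes "is_partition \<mu>" "self_conjugate \<mu>"
  shows "n \<in> beads \<mu> \<longleftrightarrow> -1 - n \<notin> beads \<mu>"
proof -
  let ?a = "\<lambda>i. int (part \<mu> i) - int i - 1"
  have sc: "j < part \<mu> i \<longleftrightarrow> i < part \<mu> j" for i j
    using assms by (simp add: self_conjugate_iff)
  have ne: "?a i + ?a j + 1 \<noteq> 0" for i j
    using sc[of j i] by linarith
  show ?thesis
  proof
    assume "n \<in> beads \<mu>"
    then obtain i where "n = ?a i" by (auto simp: beads_def)
    moreover have "-1 - ?a i \<noteq> ?a j" for j using ne[of i j] by linarith
    ultimately show "-1 - n \<notin> beads \<mu>" unfolding beads_def by blast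
  next
    assume n: "-1 - n \<notin> beads \<mu>"
    define P where "P i \<longleftrightarrow> ?a i \<le> -1 - n" for i
    have "P (nat (int (part \<mu> 0) + \<bar>n\<bar>))"
      using part_antimono[OF assms(1), of 0 "nat (int (part \<mu> 0) + \<bar>n\<bar>)"] by (simp add: P_def)
    then have Pi: "P (LEAST i. P i)" by (rule LeastI)
    define i0 where "i0 = (LEAST i. P i)"
    have Pi: "P i0" unfolding i0_def by (rule Pi)
    have "?a i0 \<in> beads \<mu>" unfolding beads_def by (rule rangeI)
    then have "?a i0 \<noteq> -1 - n" using n by metis
    then have lt: "?a i0 < -1 - n" using Pi by (simp add: P_def)
    have gt: "-1 - n < ?a i" if "i < i0" for i
      using not_less_Least[of i P] that unfolding i0_def[symmetric] by (simp add: P_def)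
    \<comment> \<open>The first \<open>i0\<close> rows are those with bead above -1-n; j is chosen
      so that a column of length \<open>i0\<close> has bead n.\<close>
    define j where "j = nat (int i0 - 1 - n)"
    have j: "int j = int i0 - 1 - n" using lt by (simp add: j_def)
    have "i < part \<mu> j \<longleftrightarrow> i < i0" for i
    proof
      assume "i < i0"
      then have "i0 - 1 < i0" "i \<le> i0 - 1" by auto
      then have "j < part \<mu> (i0 - 1)" using gt[of "i0 - 1"] j by auto
      then have "j < part \<mu> i" using part_antimono[OF assms(1) \<open>i \<le> i0 - 1\<close>] by linarith
      then show "i < part \<mu> j" using sc by blast
    next
      assume "i < part \<mu> j"
      then have "j < part \<mu> i" using sc by blast
      moreover have "part \<mu> i0 \<le> j" using lt j by simp
      ultimately show "i < i0"
        using part_antimono[OF assms(1), of i0 i] by (meson leI le_trans not_le)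
    qed
    then have "part \<mu> j = i0" by (meson linorder_neqE_nat less_irrefl)
    then have "n = ?a j" using j by simp
    then show "n \<in> beads \<mu>" unfolding beads_def by blast
  qed
qed

text \<open>If x is a bead and x - t is not, then -1-(x-t) is a bead, and it forms with x a hook of
  length exactly t. In the other direction, repeated subtraction also covers hooks whose length is a
  proper multiple of t.\<close>

lemma is_core_iff_beads:
  assumes \<mu>: "is_partition \<mu>" "self_conjugate \<mu>" and "0 < t"
  shows "is_core t \<mu> \<longleftrightarrow> (\<forall>n\<in>beads \<mu>. n - int t \<in> beads \<mu>)"
proof
  let ?a = "\<lambda>i. int (part \<mu> i) - int i - 1"
  have sc: "j < part \<mu> i \<longleftrightarrow> i < part \<mu> j" for i j
    using assms by (simp add: self_conjugate_iff)
  {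
    assume core: "is_core t \<mu>"
    show "\<forall>n\<in>beads \<mu>. n - int t \<in> beads \<mu>"
    proof (rule ballI, rule ccontr)
      fix n assume n: "n \<in> beads \<mu>" "n - int t \<notin> beads \<mu>"
      then have "-1 - (n - int t) \<in> beads \<mu>" using beads_symmetric[OF \<mu>] by blast
      then obtain i j where ij: "n = ?a i" "-1 - (n - int t) = ?a j"
        using n by (auto simp: beads_def)
      then have sum: "?a i + ?a j + 1 = int t" by simp
      have "j < part \<mu> i" using sum sc[of j i] \<open>0 < t\<close> by linarith
      from hook_length_self_conjugate[OF \<mu>(2) this] sum have "hook_length \<mu> i j = t" by linarith
      moreover have "\<not> t dvd hook_length \<mu> i j"
        using core \<open>j < part \<mu> i\<close> unfolding is_core_def young_diagram_iff[symmetric] by blast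
      ultimately show False by simp
    qed
  }
  {
    assume closed: "\<forall>n\<in>beads \<mu>. n - int t \<in> beads \<mu>"
    have iter: "n - int t * int c \<in> beads \<mu>" if "n \<in> beads \<mu>" for n c
    proof (induction c)
      case (Suc c)
      then have "n - int t * int c - int t \<in> beads \<mu>" using closed by blast
      then show ?case by (simp add: algebra_simps)
    qed (use that in simp)
    show "is_core t \<mu>"
      unfolding is_core_def
    proof safe
      fix i j assume ij: "(i, j) \<in> young_diagram \<mu>" and "t dvd hook_length \<mu> i j"
      then obtain c where "hook_length \<mu> i j = t * c" by (auto elim: dvdE)
      then have "?a i + ?a j + 1 = int t * int c"
        using hook_length_self_conjugate[OF \<mu>(2), of j i] ij by (simp add: young_diagram_iff)
      then have "?a i - int t * int c = -1 - ?a j" by linarith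
      moreover have "?a i - int t * int c \<in> beads \<mu>"
        by (rule iter) (auto simp: beads_def)
      moreover have "?a j \<in> beads \<mu>" by (auto simp: beads_def)
      ultimately show False
        using beads_symmetric[OF \<mu>, of "?a j"] by simp
    qed
  }
qed

section \<open>Recovering a partition from its beads\<close>

definition bead_count :: "int set \<Rightarrow> int \<Rightarrow> nat" where
  "bead_count S d = card {x \<in> S. d \<le> x}"

lemma finite_beads_ge:
  fixes S :: "int set"
  assumes "\<And>n. n \<in> S \<Longrightarrow> n < B"
  shows "finite {x \<in> S. d \<le> x}"
  by (rule finite_subset[of _ "{d..<B}"]) (use assms in auto)

lemma bead_count_step:
  assumes "\<And>n. n \<in> S \<Longrightarrow> n < B"
  shows "bead_count S d = bead_count S (d + 1) + of_bool (d \<in> S)"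
proof -
  have "{x \<in> S. d \<le> x} = {x \<in> S. d + 1 \<le> x} \<union> (if d \<in> S then {d} else {})"
    by (auto simp: add1_zle_eq order_le_less)
  then show ?thesis
    using finite_beads_ge[of S B "d + 1", OF assms]
    by (auto simp: bead_count_def card_insert_if)
qed

text \<open>For d \<ge> 0 the interval from -d to d - 1 splits into d pairs e, -1-e, each with
  exactly one bead.\<close>

lemma bead_count_uminus:
  assumes "\<And>n. n \<in> S \<Longrightarrow> n < B" and sym: "\<And>n. n \<in> S \<longleftrightarrow> -1 - n \<notin> S"
  shows "int (bead_count S (- d)) = int (bead_count S d) + d"
proof -
  have nonneg: "int (bead_count S (- int e)) = int (bead_count S (int e)) + int e" for e
  proof (induction e)
    case (Suc e)
    have "bead_count S (- int (Suc e)) = bead_count S (- int e) + of_bool (-1 - int e \<in> S)"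
      using bead_count_step[of S B "- int (Suc e)", OF assms(1)] by simp
    moreover have "bead_count S (int e) = bead_count S (int (Suc e)) + of_bool (int e \<in> S)"
      using bead_count_step[of S B "int e", OF assms(1)] by (simp add: add.commute)
    ultimately show ?case
      using Suc sym[of "int e"] by (auto simp: of_bool_def split: if_splits)
  qed simp
  show ?thesis
    using nonneg[of "nat d"] nonneg[of "nat (- d)"] by (cases "0 \<le> d") auto
qed

text \<open>Beads strictly decrease along the rows, so those that are at least d come from an
  initial segment of rows.\<close>

lemma bead_count_beads:
  assumes "is_partition \<mu>"
  shows "i < bead_count (beads \<mu>) d \<longleftrightarrow> d \<le> int (part \<mu> i) - int i - 1"
proof -
  define a where "a i = int (part \<mu> i) - int i - 1" for i
  have anti: "a j < a i" if "i < j" for i j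
    using part_antimono[OF assms, of i j] that by (auto simp: a_def)
  then have inj: "inj a"
    by (intro linorder_injI) (metis less_irrefl)
  have down: "i \<le> j \<Longrightarrow> d \<le> a j \<Longrightarrow> d \<le> a i" for i j
    using anti[of i j] by (cases "i = j") auto
  define c where "c = (LEAST i. \<not> d \<le> a i)"
  have "\<not> d \<le> a (nat (int (part \<mu> 0) + \<bar>d\<bar>))"
    using part_antimono[OF assms, of 0 "nat (int (part \<mu> 0) + \<bar>d\<bar>)"] by (simp add: a_def)
  then have c: "\<not> d \<le> a c" unfolding c_def by (rule LeastI)
  have iff: "d \<le> a i \<longleftrightarrow> i < c" for i
    using down[of c i] c not_less_Least[of i "\<lambda>i. \<not> d \<le> a i"] unfolding c_def
    by (meson not_le)
  have "{x \<in> beads \<mu>. d \<le> x} = a ` {..<c}"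
    using iff by (auto simp: beads_def a_def[symmetric])
  then have "bead_count (beads \<mu>) d = c"
    using inj by (simp add: bead_count_def card_image inj_on_subset)
  then show ?thesis using iff by (simp add: a_def)
qed

lemma inj_on_beads: "inj_on beads {\<mu>. is_partition \<mu>}"
proof (rule inj_onI)
  fix \<mu> \<nu> assume p: "\<mu> \<in> {\<mu>. is_partition \<mu>}" "\<nu> \<in> {\<mu>. is_partition \<mu>}"
    and eq: "beads \<mu> = beads \<nu>"
  have "d \<le> int (part \<mu> i) - int i - 1 \<longleftrightarrow> d \<le> int (part \<nu> i) - int i - 1" for d i
    using bead_count_beads p eq by (metis mem_Collect_eq)
  then have "int (part \<mu> i) - int i - 1 = int (part \<nu> i) - int i - 1" for i
    by (meson order_antisym order_refl)
  then have "part \<mu> = part \<nu>" by auto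
  then show "\<mu> = \<nu>" using p by (intro partition_eqI) auto
qed

lemma symmetric_beads_realizable:
  assumes bound: "\<And>n. n \<in> S \<Longrightarrow> n < B" and sym: "\<And>n. n \<in> S \<longleftrightarrow> -1 - n \<notin> S"
  obtains \<mu> where "is_partition \<mu>" "self_conjugate \<mu>" "beads \<mu> = S"
proof -
  let ?N = "bead_count S"
  note step = bead_count_step[of S B, OF bound]
  note neg = bead_count_uminus[of S B, OF bound sym]
  have N_anti: "?N e \<le> ?N d" if "d \<le> e" for d e
    unfolding bead_count_def by (rule card_mono) (use finite_beads_ge[OF bound] that in auto)
  \<comment> \<open>Forced by \<open>bead_count_beads\<close> with d = j - i. The symmetry of the
    diagram then becomes \<open>bead_count_uminus\<close>.\<close>
  define inside where "inside i j \<longleftrightarrow> i < ?N (int j - int i)" for i j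
  have inside_sym: "inside i j \<longleftrightarrow> inside j i" for i j
  proof -
    have "int (?N (int i - int j)) = int (?N (int j - int i)) + (int j - int i)"
      using neg[of "int j - int i"] by simp
    then show ?thesis unfolding inside_def by linarith
  qed
  have inside_down: "inside i j'" if "inside i j" "j' \<le> j" for i j j'
    using that N_anti[of "int j' - int i" "int j - int i"] by (auto simp: inside_def)
  have outside: "\<exists>j. \<not> inside i j" for i
  proof
    have "{x \<in> S. B \<le> x} = {}" using bound by force
    then have "?N B = 0" unfolding bead_count_def by (simp only: card.empty)
    then have "?N (int (i + nat B) - int i) = 0" using N_anti[of B "int (nat B)"] by simp
    then show "\<not> inside i (i + nat B)" by (simp add: inside_def)
  qed
  define f where "f i = (LEAST j. \<not> inside i j)" for i
  have f: "inside i j \<longleftrightarrow> j < f i" for i j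
  proof
    show "inside i j \<Longrightarrow> j < f i"
      using LeastI_ex[OF outside, of i] inside_down unfolding f_def by (meson not_le)
    show "j < f i \<Longrightarrow> inside i j"
      using not_less_Least unfolding f_def by blast
  qed
  have f_sym: "j < f i \<longleftrightarrow> i < f j" for i j
    using f inside_sym by blast
  have f_anti: "f j \<le> f i" if "i \<le> j" for i j
  proof (rule ccontr)
    assume "\<not> f j \<le> f i"
    then have "j < f (f i)" using f_sym[of "f i" j] by simp
    then have "i < f (f i)" using that by simp
    then show False using f_sym by blast
  qed
  define \<mu> where "\<mu> = map f [0..<f 0]"
  have part: "part \<mu> = f"
  proof
    fix i
    show "part \<mu> i = f i" using f_sym[of 0 i] by (auto simp: part_def \<mu>_def)
  qed
  have "is_partition \<mu>"
    unfolding is_partition_def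
  proof
    show "sorted_wrt (\<ge>) \<mu>"
      using f_anti by (auto simp: \<mu>_def sorted_wrt_iff_nth_less)
    show "0 \<notin> set \<mu>"
    proof
      assume "0 \<in> set \<mu>"
      then obtain i where "i < f 0" "f i = 0" by (auto simp: \<mu>_def)
      moreover have "0 < f i" using f_sym \<open>i < f 0\<close> by blast
      ultimately show False by simp
    qed
  qed
  moreover have "self_conjugate \<mu>"
    unfolding self_conjugate_iff part using f_sym by blast
  moreover have "beads \<mu> = S"
  proof -
    have "int (f i) - int i - 1 \<in> S" for i
    proof -
      have "\<not> i < ?N (int (f i) - int i)"
        using f[of i "f i"] by (simp add: inside_def)
      moreover have "i < ?N (int (f i) - int i - 1)"
      proof (cases "f i")
        case 0
        then show ?thesis using neg[of "int i + 1"] by simp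
      next
        case (Suc j)
        then show ?thesis using f[of i j] by (simp add: inside_def)
      qed
      ultimately show ?thesis
        using step[of "int (f i) - int i - 1"] by (intro ccontr[of "_ \<in> S"]) simp
    qed
    moreover have "x \<in> range (\<lambda>i. int (f i) - int i - 1)" if "x \<in> S" for x
    proof -
      define i where "i = ?N (x + 1)"
      have Nx: "?N x = Suc i" using step[of x] that by (simp add: i_def)
      have "0 \<le> x + int i + 1" using neg[of "- x"] Nx by simp
      then obtain j where j: "int j = x + int i + 1" by (metis nonneg_int_cases)
      have "\<not> j < f i"
        using f[of i j] j by (simp add: inside_def i_def)
      moreover have "j' < f i" if "Suc j' = j" for j'
      proof -
        have "int j' - int i = x" using j that by linarith
        then show ?thesis using f[of i j'] Nx by (simp add: inside_def)
      qed
      ultimately have "f i = j" by (cases j) (auto simp: less_Suc_eq_le intro: le_antisym)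
      then have "x = int (f i) - int i - 1" using j by simp
      then show ?thesis by blast
    qed
    ultimately show ?thesis by (auto simp: beads_def part)
  qed
  ultimately show thesis by (rule that)
qed

text \<open>Since s and s + 1 are coprime, a large 2n + 1 is a combination of them, and
  subtracting it from n would give -1-n.\<close>

lemma symmetric_beads_bounded:
  assumes S: "S \<in> symmetric_bead_sets T" and "s \<in> T" "Suc s \<in> T" "0 < s" and n: "n \<in> S"
  shows "n < int s * int s"
proof (rule ccontr)
  assume large: "\<not> n < int s * int s"
  have closed: "n - int t * int c \<in> S" if "t \<in> T" "n \<in> S" for t n c
  proof (induction c)
    case (Suc c)
    then have "n - int t * int c - int t \<in> S"
      using S \<open>t \<in> T\<close> unfolding symmetric_bead_sets_def by blast
    then show ?case by (simp add: algebra_simps)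
  qed (use that in simp)
  define N where "N = nat (2 * n + 1)"
  have "0 \<le> int s * int s" by simp
  then have N: "int N = 2 * n + 1"
    using large unfolding N_def by linarith
  then have "int (s * s) \<le> int N"
    using large \<open>0 \<le> int s * int s\<close> by simp
  then have ss: "s * s \<le> N"
    by (simp only: of_nat_le_iff)
  \<comment> \<open>Write N = s u + v with v < s; then N = s (u - v) + (s + 1) v, and u - v is not
    negative because s \<le> u.\<close>
  define a b where "a = N div s - N mod s" and "b = N mod s"
  have "N mod s < s" using \<open>0 < s\<close> by simp
  moreover have "s \<le> N div s" using ss \<open>0 < s\<close> by (metis div_le_mono nonzero_mult_div_cancel_left less_irrefl)
  ultimately have "N div s = a + b" by (simp add: a_def b_def)
  then have "N = s * a + Suc s * b"
    using mult_div_mod_eq[of s N] by (simp add: b_def[symmetric] algebra_simps)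
  then have "int N = int s * int a + int (Suc s) * int b"
    by (metis of_nat_add of_nat_mult)
  then have "n - int s * int a - int (Suc s) * int b = -1 - n"
    using N by linarith
  moreover have "n - int s * int a - int (Suc s) * int b \<in> S"
    by (intro closed assms)
  ultimately have "-1 - n \<in> S"
    by (simp only:)
  moreover have "-1 - n \<notin> S"
    using S n unfolding symmetric_bead_sets_def by blast
  ultimately show False by blast
qed

lemma card_self_conjugate_cores:
  assumes T: "0 \<notin> T" "s \<in> T" "Suc s \<in> T"
  shows "card (self_conjugate_cores T) = card (symmetric_bead_sets T)"
proof -
  have pos: "0 < t" if "t \<in> T" for t
    using T(1) that by (cases t) auto
  have "beads ` self_conjugate_cores T = symmetric_bead_sets T"
  proof (intro equalityI subsetI)
    fix S assume "S \<in> beads ` self_conjugate_cores T"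
    then obtain \<mu> where S: "S = beads \<mu>" and \<mu>: "is_partition \<mu>" "self_conjugate \<mu>"
      and core: "\<And>t. t \<in> T \<Longrightarrow> is_core t \<mu>"
      by (auto simp: self_conjugate_cores_def)
    have "\<forall>n\<in>beads \<mu>. n - int t \<in> beads \<mu>" if "t \<in> T" for t
      using core[OF that] unfolding is_core_iff_beads[OF \<mu> pos[OF that]] .
    then show "S \<in> symmetric_bead_sets T"
      unfolding S symmetric_bead_sets_def
      by (intro CollectI conjI allI ballI[of T] beads_symmetric[OF \<mu>])
  next
    fix S assume S: "S \<in> symmetric_bead_sets T"
    then have sym: "n \<in> S \<longleftrightarrow> -1 - n \<notin> S" for n
      unfolding symmetric_bead_sets_def by (elim CollectE conjE allE)
    have "\<forall>t\<in>T. \<forall>n\<in>S. n - int t \<in> S"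
      using S unfolding symmetric_bead_sets_def by (elim CollectE conjE)
    then have closed: "\<forall>n\<in>S. n - int t \<in> S" if "t \<in> T" for t
      using that by (rule bspec)
    have "n < int s * int s" if "n \<in> S" for n
      by (rule symmetric_beads_bounded[OF S T(2,3) pos[OF T(2)] that])
    then obtain \<mu> where \<mu>: "is_partition \<mu>" "self_conjugate \<mu>" "beads \<mu> = S"
      by (rule symmetric_beads_realizable[OF _ sym])
    have "is_core t \<mu>" if "t \<in> T" for t
      unfolding is_core_iff_beads[OF \<mu>(1,2) pos[OF that]] \<mu>(3) by (rule closed[OF that])
    then show "S \<in> beads ` self_conjugate_cores T"
      unfolding self_conjugate_cores_def \<mu>(3)[symmetric] using \<mu>(1,2) by blast
  qed
  moreover have "inj_on beads (self_conjugate_cores T)"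
    by (rule inj_on_subset[OF inj_on_beads]) (auto simp: self_conjugate_cores_def)
  ultimately show ?thesis by (metis card_image)
qed

subsection \<open>Half paths and unrestricted walks\<close>

text \<open>The number of walks of width X/2 and net height j with the (2k+1)-Dyck steps, without any
  positivity condition; widths are doubled to make them integers.\<close>

function walks :: "nat \<Rightarrow> int \<Rightarrow> int \<Rightarrow> int" where
  "walks k X j =
     (if X < 0 then 0
      else of_bool (X = 0 \<and> j = 0) + (\<Sum>l = 1..2 * k. walks k (X - 2 * int l) j)
        + walks k (X - (2 * int k + 1)) (j - 1) + walks k (X - (2 * int k + 1)) (j + 1))"
  by auto
termination
  by (relation "measure (\<lambda>(k, X, j). nat (X + 1))") auto

declare walks.simps [simp del]

lemma walks_neg: "X < 0 \<Longrightarrow> walks k X j = 0"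
  by (simp add: walks.simps)

lemma walks_rec:
  "walks k X j = of_bool (X = 0 \<and> j = 0) + (\<Sum>l = 1..2 * k. walks k (X - 2 * int l) j)
     + walks k (X - (2 * int k + 1)) (j - 1) + walks k (X - (2 * int k + 1)) (j + 1)"
proof (cases "X < 0")
  case True
  then show ?thesis by (simp add: walks_neg)
next
  case False
  then show ?thesis by (subst walks.simps) simp
qed

text \<open>Net height j takes at least \<bar>j\<bar> vertical steps, each of doubled width
  2k+1.\<close>

lemma walks_eq_0_if_steep:
  "X < (2 * int k + 1) * \<bar>j\<bar> \<Longrightarrow> walks k X j = 0"
proof (induction k X j rule: walks.induct)
  case (1 k X j)
  show ?case
  proof (cases "X < 0")
    case False
    have "walks k (X - 2 * int l) j = 0" if "l \<in> {1..2 * k}" for l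
      using 1(1)[OF False that] 1(4) by simp
    moreover have "(2 * int k + 1) * \<bar>j\<bar> \<le> (2 * int k + 1) * (\<bar>j'\<bar> + 1)"
      if "j' = j - 1 \<or> j' = j + 1" for j'
      by (rule mult_left_mono) (use that in auto)
    then have "X - (2 * int k + 1) < (2 * int k + 1) * \<bar>j'\<bar>"
      if "j' = j - 1 \<or> j' = j + 1" for j'
      using 1(4) that by (force simp: algebra_simps)
    moreover have "X \<noteq> 0 \<or> j \<noteq> 0"
      using 1(4) by auto
    ultimately show ?thesis
      using False 1(2,3) by (simp add: walks.simps[of k X])
  qed (simp add: walks_neg)
qed

text \<open>Horizontal steps have even doubled width, vertical ones odd. This removes half of the
  terms from the Dyck sum.\<close>

lemma walks_eq_0_if_parity: "odd (X - j) \<Longrightarrow> walks k X j = 0"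
proof (induction k X j rule: walks.induct)
  case (1 k X j)
  show ?case
  proof (cases "X < 0")
    case False
    have "walks k (X - 2 * int l) j = 0" if "l \<in> {1..2 * k}" for l
      using 1(1)[OF False that] 1(4) by auto
    moreover have "X \<noteq> 0 \<or> j \<noteq> 0"
      using 1(4) by auto
    ultimately show ?thesis
      using False 1(2,3,4) by (simp add: walks.simps[of k X])
  qed (simp add: walks_neg)
qed

text \<open>With an arbitrary starting point and a free final height, the family is closed under
  removal of the first step.\<close>

definition half_paths :: "nat \<Rightarrow> real \<Rightarrow> real \<times> real \<Rightarrow> (real \<times> real) list set" where
  "half_paths K e P =
     {p. p \<noteq> [] \<and> hd p = P \<and> successively (\<lambda>P Q. Q - P \<in> dyck_steps K) p \<and>
         (\<forall>(x, y)\<in>set p. 0 \<le> y) \<and> fst (last p) = e}"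

lemma dyck_steps_eq:
  "dyck_steps K = insert (real K / 2, 1) (insert (real K / 2, -1) ((\<lambda>l. (real l, 0)) ` {1..<K}))"
  by (auto simp: dyck_steps_def)

lemma finite_dyck_steps: "finite (dyck_steps K)"
  by (simp add: dyck_steps_eq)

lemma sum_dyck_steps:
  "sum f (dyck_steps K) =
     f (real K / 2, 1) + (f (real K / 2, -1) + (\<Sum>l = 1..<K. f (real l, 0)))"
proof -
  have "sum f ((\<lambda>l. (real l, 0)) ` {1..<K}) = (\<Sum>l = 1..<K. f (real l, 0))"
    by (subst sum.reindex) (auto simp: inj_on_def)
  then show ?thesis
    by (auto simp: dyck_steps_eq image_iff)
qed

lemma half_paths_eq_empty_if_below: "snd P < 0 \<Longrightarrow> half_paths K e P = {}"
  by (cases P) (use hd_in_set in \<open>fastforce simp: half_paths_def\<close>)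

lemma half_paths_rec:
  assumes "0 \<le> snd P"
  shows "half_paths K e P =
    (if fst P = e then {[P]} else {}) \<union> (\<Union>d\<in>dyck_steps K. (#) P ` half_paths K e (P + d))"
    (is "_ = ?R")
proof (intro equalityI subsetI)
  fix p assume p: "p \<in> half_paths K e P"
  then obtain p' where p': "p = P # p'"
    by (cases p) (auto simp: half_paths_def)
  show "p \<in> ?R"
  proof (cases p')
    case Nil
    then show ?thesis using p p' by (auto simp: half_paths_def)
  next
    case (Cons Q p'')
    with p p' have "Q - P \<in> dyck_steps K" "p' \<in> half_paths K e (P + (Q - P))"
      by (auto simp: half_paths_def)
    then show ?thesis
      unfolding p' by blast
  qed
next
  fix p assume "p \<in> ?R"
  then show "p \<in> half_paths K e P"
    using assms by (auto simp: half_paths_def successively_Cons split: if_splits)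
qed

lemma half_paths_eq_empty_if_right:
  assumes "e < fst P"
  shows "half_paths K e P = {}"
proof -
  have "fst (hd p) \<le> fst (last p)"
    if "successively (\<lambda>P Q. Q - P \<in> dyck_steps K) p" "p \<noteq> []" for p
    using that
  proof (induction p)
    case (Cons P p)
    show ?case
    proof (cases p)
      case (Cons Q p')
      then have "fst P \<le> fst Q"
        using \<open>successively _ (P # p)\<close> by (cases P; cases Q) (auto simp: dyck_steps_def)
      then show ?thesis using Cons.IH Cons.prems Cons by (auto simp: successively_Cons)
    qed auto
  qed auto
  then show ?thesis using assms by (force simp: half_paths_def)
qed

lemma card_half_paths_rec:
  assumes "0 \<le> snd P" and fin: "\<And>d. d \<in> dyck_steps K \<Longrightarrow> finite (half_paths K e (P + d))"
  shows "finite (half_paths K e P)"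
    and "card (half_paths K e P) =
      of_bool (fst P = e) + (\<Sum>d\<in>dyck_steps K. card (half_paths K e (P + d)))"
proof -
  let ?U = "\<Union>d\<in>dyck_steps K. (#) P ` half_paths K e (P + d)"
  have finU: "finite ?U"
    using fin finite_dyck_steps by auto
  show "finite (half_paths K e P)"
    unfolding half_paths_rec[OF assms(1)] using finU by simp
  have "card ?U = (\<Sum>d\<in>dyck_steps K. card ((#) P ` half_paths K e (P + d)))"
    by (intro card_UN_disjoint) (use fin finite_dyck_steps in \<open>auto simp: half_paths_def\<close>)
  also have "\<dots> = (\<Sum>d\<in>dyck_steps K. card (half_paths K e (P + d)))"
    by (intro sum.cong refl card_image) (auto simp: inj_on_def)
  finally have cardU: "card ?U = (\<Sum>d\<in>dyck_steps K. card (half_paths K e (P + d)))" .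
  have "[P] \<notin> ?U"
    by (auto simp: half_paths_def)
  then show "card (half_paths K e P) =
      of_bool (fst P = e) + (\<Sum>d\<in>dyck_steps K. card (half_paths K e (P + d)))"
    unfolding half_paths_rec[OF assms(1)] using finU cardU by simp
qed

text \<open>Paths of a given width that start at height h and stay weakly above the axis correspond to
  unrestricted paths with a net height in [-h-1, h]: both numbers satisfy the same recursion.\<close>

lemma card_half_paths:
  assumes "-1 \<le> h"
  shows "finite (half_paths (2 * k + 1) e (e - real_of_int X / 2, real_of_int h)) \<and>
    int (card (half_paths (2 * k + 1) e (e - real_of_int X / 2, real_of_int h))) =
      (\<Sum>j = -h-1..h. walks k X j)"
  using assms
proof (induction "nat (X + 1)" arbitrary: X h rule: less_induct)
  case less
  let ?K = "2 * k + 1"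
  let ?H = "\<lambda>X h. half_paths ?K e (e - real_of_int X / 2, real_of_int h)"
  have IH: "finite (?H X' h')" "int (card (?H X' h')) = (\<Sum>j = -h'-1..h'. walks k X' j)"
    if "X' < X" "-1 \<le> h'" "0 \<le> X" for X' h'
    using less(1)[of X' h'] that by auto
  consider "X < 0" | "h = -1" | "0 \<le> X" "0 \<le> h"
    using less.prems by linarith
  then show ?case
  proof cases
    case 1
    then show ?thesis by (simp add: half_paths_eq_empty_if_right walks_neg)
  next
    \<comment> \<open>Height -1 is the absorbing barrier of the recursion: no paths on one side, an
      empty range of net heights on the other.\<close>
    case 2
    then show ?thesis by (simp add: half_paths_eq_empty_if_below)
  next
    case 3
    let ?P = "(e - real_of_int X / 2, real_of_int h)"
    have up: "half_paths ?K e (?P + (real ?K / 2, 1)) = ?H (X - ?K) (h + 1)"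
      and down: "half_paths ?K e (?P + (real ?K / 2, -1)) = ?H (X - ?K) (h - 1)"
      by (intro arg_cong[of _ _ "half_paths ?K e"]; simp add: field_simps)+
    have flat: "half_paths ?K e (?P + (real l, 0)) = ?H (X - 2 * int l) h" for l
      by (intro arg_cong[of _ _ "half_paths ?K e"]; simp add: field_simps)
    have fin: "finite (half_paths ?K e (?P + d))" if "d \<in> dyck_steps ?K" for d
      using that unfolding dyck_steps_eq
    proof (elim insertE imageE)
      show "finite (half_paths ?K e (?P + d))" if "d = (real ?K / 2, 1)"
        unfolding that up by (rule IH) (use 3 in auto)
      show "finite (half_paths ?K e (?P + d))" if "d = (real ?K / 2, -1)"
        unfolding that down by (rule IH) (use 3 in auto)
      show "finite (half_paths ?K e (?P + d))" if "d = (real l, 0)" "l \<in> {1..<?K}" for l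
        unfolding that flat by (rule IH) (use 3 that in auto)
    qed
    have "int (card (?H X h)) = of_bool (X = 0) +
        (\<Sum>d\<in>dyck_steps ?K. int (card (half_paths ?K e (?P + d))))"
      by (subst card_half_paths_rec(2)) (use 3 fin in auto)
    also have "(\<Sum>d\<in>dyck_steps ?K. int (card (half_paths ?K e (?P + d)))) =
        int (card (?H (X - ?K) (h + 1))) + (int (card (?H (X - ?K) (h - 1))) +
        (\<Sum>l = 1..<?K. int (card (?H (X - 2 * int l) h))))"
      unfolding sum_dyck_steps up down flat ..
    also have "(\<Sum>l = 1..<?K. int (card (?H (X - 2 * int l) h))) =
        (\<Sum>l = 1..<?K. \<Sum>j = -h-1..h. walks k (X - 2 * int l) j)"
      by (intro sum.cong refl IH) (use 3 in auto)
    also have "\<dots> = (\<Sum>j = -h-1..h. \<Sum>l = 1..2 * k. walks k (X - 2 * int l) j)"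
      by (subst sum.swap) (simp add: atLeastLessThanSuc_atLeastAtMost)
    also have "int (card (?H (X - ?K) (h + 1))) = (\<Sum>j = -2-h..h+1. walks k (X - ?K) j)"
      by (subst IH) (use 3 in auto)
    also have "int (card (?H (X - ?K) (h - 1))) = (\<Sum>j = -h..h-1. walks k (X - ?K) j)"
      by (subst IH) (use 3 in auto)
    finally have card: "int (card (?H X h)) = of_bool (X = 0) +
        ((\<Sum>j = -2-h..h+1. walks k (X - ?K) j) + ((\<Sum>j = -h..h-1. walks k (X - ?K) j) +
         (\<Sum>j = -h-1..h. \<Sum>l = 1..2 * k. walks k (X - 2 * int l) j)))" .
    have shift: "(\<Sum>j = -h-1..h. f (j + c)) = (\<Sum>j = -h-1+c..h+c. f j)" for f :: "int \<Rightarrow> int" and c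
      by (rule sum.reindex_bij_witness[of _ "\<lambda>j. j - c" "\<lambda>j. j + c"]) auto
    \<comment> \<open>The left-hand ranges belong to starting heights h + 1 and h - 1, the
      right-hand ones are the translates of the range for h by -1 and 1. Exchanging the tail
      {h..h+1} between them plays the role of the reflection principle.\<close>
    have split: "(\<Sum>j = -2-h..h+1. f j) + (\<Sum>j = -h..h-1. f j) =
        (\<Sum>j = -2-h..h-1. f j) + (\<Sum>j = -h..h+1. f j)" for f :: "int \<Rightarrow> int"
    proof -
      have "{-2-h..h+1} = {-2-h..h-1} \<union> {h..h+1}" "{-2-h..h-1} \<inter> {h..h+1} = {}"
        and "{-h..h+1} = {-h..h-1} \<union> {h..h+1}" "{-h..h-1} \<inter> {h..h+1} = {}"
        using 3 by auto
      then show ?thesis by (simp add: sum.union_disjoint)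
    qed
    have "(\<Sum>j = -h-1..h. walks k X j) =
       (\<Sum>j = -h-1..h. of_bool (X = 0 \<and> j = 0)) +
       (\<Sum>j = -h-1..h. \<Sum>l = 1..2 * k. walks k (X - 2 * int l) j) +
       (\<Sum>j = -h-1..h. walks k (X - ?K) (j + (-1))) + (\<Sum>j = -h-1..h. walks k (X - ?K) (j + 1))"
      using 3 by (simp add: walks.simps[of k X] sum.distrib add.commute[of 1 "2 * int k"])
    also have "(\<Sum>j = -h-1..h. of_bool (X = 0 \<and> j = 0)) = (of_bool (X = 0) :: int)"
      using 3 by (cases "X = 0") (auto simp: of_bool_def)
    finally show ?thesis
      using card card_half_paths_rec(1)[of ?P, OF _ fin] split[of "walks k (X - ?K)"] 3
      unfolding shift by simp
  qed
qed

subsection \<open>Symmetric Dyck paths\<close>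

abbreviation reflect_point :: "nat \<Rightarrow> real \<times> real \<Rightarrow> real \<times> real" where
  "reflect_point s \<equiv> \<lambda>(x, y). (real s - x, y)"

text \<open>A symmetric path is determined by its part left of the central horizontal step of
  length l, where l = 0 means that the path has a central vertex.\<close>

definition unfold_path :: "nat \<Rightarrow> nat \<Rightarrow> (real \<times> real) list \<Rightarrow> (real \<times> real) list" where
  "unfold_path s l u = u @ (if l = 0 then tl (reflect_path s u) else reflect_path s u)"

lemma reflect_step_iff:
  "reflect_point s P - reflect_point s Q \<in> dyck_steps K \<longleftrightarrow> Q - P \<in> dyck_steps K"
  by (cases P; cases Q) (auto simp: dyck_steps_def)

lemma reflect_reflect_path [simp]: "reflect_path s (reflect_path s p) = p"
  by (simp add: reflect_path_def rev_map comp_def case_prod_beta)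

lemma length_reflect_path [simp]: "length (reflect_path s p) = length p"
  by (simp add: reflect_path_def)

lemma reflect_path_eq_Nil_iff [simp]: "reflect_path s p = [] \<longleftrightarrow> p = []"
  by (simp add: reflect_path_def)

lemma reflect_path_append: "reflect_path s (p @ q) = reflect_path s q @ reflect_path s p"
  by (simp add: reflect_path_def)

lemma hd_reflect_path: "p \<noteq> [] \<Longrightarrow> hd (reflect_path s p) = reflect_point s (last p)"
  by (simp add: reflect_path_def hd_rev last_map)

lemma last_reflect_path: "p \<noteq> [] \<Longrightarrow> last (reflect_path s p) = reflect_point s (hd p)"
  by (simp add: reflect_path_def last_rev hd_map)

lemma successively_reflect_path:
  "successively (\<lambda>P Q. Q - P \<in> dyck_steps K) (reflect_path s p) \<longleftrightarrow>
   successively (\<lambda>P Q. Q - P \<in> dyck_steps K) p"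
  unfolding reflect_path_def successively_rev successively_map reflect_step_iff ..

lemma unfold_path_in_symmetric:
  assumes "0 < s" "l < K" and u: "u \<in> half_paths K ((real s - real l) / 2) (0, 0)"
  shows "unfold_path s l u \<in> symmetric_dyck_paths s K"
proof -
  let ?succ = "successively (\<lambda>P Q. Q - P \<in> dyck_steps K)"
  let ?v = "reflect_path s u"
  from u have ne: "u \<noteq> []" and hd: "hd u = (0, 0)" and succ: "?succ u" "?succ ?v"
    and nonneg: "\<forall>(x, y)\<in>set u. 0 \<le> y" and lst: "fst (last u) = (real s - real l) / 2"
    by (auto simp: half_paths_def successively_reflect_path)
  have nonneg': "\<forall>(x, y)\<in>set ?v. 0 \<le> y"
    using nonneg by (auto simp: reflect_path_def)
  show ?thesis
  proof (cases "l = 0")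
    case True
    then have hdv: "hd ?v = last u"
      using lst ne by (cases "last u") (simp add: hd_reflect_path)
    obtain v' where v: "?v = last u # v'"
      using hdv ne by (cases ?v) auto
    have uf: "unfold_path s l u = u @ v'"
      using True v by (simp add: unfold_path_def)
    \<comment> \<open>A single vertex would have to be both the origin and a point on the axis of
      symmetry, which differ as s > 0.\<close>
    have len: "v' \<noteq> []"
    proof
      assume "v' = []"
      then have "length ?v = 1" using v by simp
      then obtain P where "u = [P]" by (auto simp: length_Suc_conv)
      then show False using hd lst True \<open>0 < s\<close> by simp
    qed
    have "reflect_path s (u @ v') = u @ v'"
    proof -
      have "u = butlast u @ [last u]" using ne by simp
      then have "u @ v' = butlast u @ ?v" using v by (metis append.assoc append_Cons append_Nil)
      moreover have "reflect_path s (butlast u) = v'"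
      proof -
        have "reflect_path s (butlast u @ [last u]) = last u # v'"
          using ne v by simp
        then show ?thesis by (simp add: reflect_path_def)
      qed
      ultimately show ?thesis by (simp add: reflect_path_append)
    qed
    moreover have "?succ (u @ v')"
      using succ len unfolding v
      by (auto simp: successively_append_iff successively_Cons)
    moreover have "last (u @ v') = (real s, 0)"
      using len last_reflect_path[OF ne, of s] hd unfolding v by simp
    ultimately show ?thesis
      using ne hd nonneg nonneg' unfolding uf v
      by (auto simp: symmetric_dyck_paths_def dyck_path_def)
  next
    case False
    have "hd ?v - last u \<in> dyck_steps K"
      using lst ne False \<open>l < K\<close>
      by (cases "last u") (auto simp: hd_reflect_path dyck_steps_def intro!: exI[of _ l])
    then show ?thesis
      using False ne hd succ nonneg nonneg' last_reflect_path[OF ne, of s]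
      by (auto simp: symmetric_dyck_paths_def dyck_path_def unfold_path_def
          successively_append_iff reflect_path_append)
  qed
qed

text \<open>The parity of the number of vertices decides what the axis of symmetry meets: a middle
  step if it is even, a middle vertex if it is odd.\<close>

lemma symmetric_imp_unfold_path:
  assumes p: "p \<in> symmetric_dyck_paths s K" and "0 < K"
  obtains l u where "l < K" "u \<in> half_paths K ((real s - real l) / 2) (0, 0)" "p = unfold_path s l u"
proof -
  let ?succ = "successively (\<lambda>P Q. Q - P \<in> dyck_steps K)"
  from p have ne: "p \<noteq> []" and hd: "hd p = (0, 0)" and succ: "?succ p"
    and nonneg: "\<forall>(x, y)\<in>set p. 0 \<le> y" and sym: "reflect_path s p = p"
    by (auto simp: symmetric_dyck_paths_def dyck_path_def)
  have part: "u \<in> half_paths K e (0, 0)" if "p = u @ v" "u \<noteq> []" "fst (last u) = e" for u v e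
    using that hd succ nonneg by (auto simp: half_paths_def successively_append_iff)
  show thesis
  proof (cases "even (length p)")
    case True
    then obtain c where c: "length p = c + c" by (metis evenE mult_2)
    define u where "u = take c p"
    define v where "v = drop c p"
    have puv: "p = u @ v" and len: "length u = c" "length v = c"
      using c by (simp_all add: u_def v_def)
    have "reflect_path s v @ reflect_path s u = u @ v"
      using sym unfolding puv reflect_path_append .
    then have v: "v = reflect_path s u"
      using len by simp
    have une: "u \<noteq> []" using ne puv v by auto
    have "hd v - last u \<in> dyck_steps K"
      using succ une v unfolding puv successively_append_iff by auto
    \<comment> \<open>The middle step joins a point to its mirror image at the same height, so it is
      horizontal.\<close>
    then obtain l where l: "l < K" "l \<noteq> 0" "real s - 2 * fst (last u) = real l"
      unfolding v hd_reflect_path[OF une] by (cases "last u") (auto simp: dyck_steps_def)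
    show thesis
      by (rule that[of l u])
        (use l puv v in \<open>auto simp: unfold_path_def intro!: part[OF puv une]\<close>)
  next
    case False
    then obtain c where c: "length p = Suc (c + c)" by (metis oddE mult_2 Suc_eq_plus1)
    define u where "u = take c p"
    define v where "v = drop (Suc c) p"
    define P where "P = p ! c"
    have puv: "p = u @ P # v" and len: "length u = c" "length v = c"
      using c by (simp_all add: u_def v_def P_def id_take_nth_drop)
    have "reflect_path s v @ reflect_point s P # reflect_path s u = u @ P # v"
      using sym unfolding puv
      by (simp add: reflect_path_def)
    then have v: "v = reflect_path s u" and P: "reflect_point s P = P"
      using len by auto
    show thesis
    proof (rule that[of 0 "u @ [P]"])
      show "u @ [P] \<in> half_paths K ((real s - real 0) / 2) (0, 0)"
        by (rule part[of _ v]) (use puv P in \<open>auto split: prod.splits\<close>)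
      show "p = unfold_path s 0 (u @ [P])"
        using puv v by (simp add: unfold_path_def reflect_path_def)
    qed fact
  qed
qed

text \<open>The number of vertices determines the length of the left part, since its parity tells
  whether l = 0; the abscissa where that part ends then gives l.\<close>

lemma unfold_path_inject:
  assumes "unfold_path s l u = unfold_path s l' u'"
    and "u \<in> half_paths K ((real s - real l) / 2) P" "u' \<in> half_paths K ((real s - real l') / 2) P"
  shows "l = l' \<and> u = u'"
proof -
  have ne: "u \<noteq> []" "u' \<noteq> []"
    and lst: "fst (last u) = (real s - real l) / 2" "fst (last u') = (real s - real l') / 2"
    using assms(2,3) by (auto simp: half_paths_def)
  have len: "length (unfold_path s l u) = 2 * length u - of_bool (l = 0)" for l u
    by (cases "l = 0") (simp_all add: unfold_path_def mult_2)
  have "2 * length u - of_bool (l = 0) = 2 * length u' - of_bool (l' = 0)"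
    using assms(1) len by metis
  moreover have "length u > 0" "length u' > 0" using ne by auto
  ultimately have "length u = length u'"
    by (auto simp: of_bool_def split: if_splits; presburger)
  then have "u = u'"
    using assms(1) by (simp add: unfold_path_def)
  with lst show ?thesis by simp
qed

text \<open>A half of width (s - l)/2 has doubled width s - l, and starting height 0 allows exactly
  the net heights -1 and 0.\<close>

lemma card_symmetric_dyck_paths:
  assumes "0 < s"
  shows "int (card (symmetric_dyck_paths s (2 * k + 1))) =
    (\<Sum>l = 0..2 * k. walks k (int s - int l) (-1) + walks k (int s - int l) 0)"
proof -
  let ?K = "2 * k + 1"
  let ?H = "\<lambda>l. half_paths ?K ((real s - real l) / 2) (0, 0)"
  have "{-1..0} = {-1, 0 :: int}"
    by auto
  then have H: "finite (?H l)" "int (card (?H l)) = walks k (int s - int l) (-1) + walks k (int s - int l) 0"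
    for l
    using card_half_paths[of 0 k "(real s - real l) / 2" "int s - int l"]
    by simp_all
  have "symmetric_dyck_paths s ?K = (\<Union>l\<in>{0..2 * k}. unfold_path s l ` ?H l)"
  proof (intro equalityI subsetI)
    fix p assume "p \<in> symmetric_dyck_paths s ?K"
    then show "p \<in> (\<Union>l\<in>{0..2 * k}. unfold_path s l ` ?H l)"
      by (rule symmetric_imp_unfold_path) force+
  next
    fix p assume "p \<in> (\<Union>l\<in>{0..2 * k}. unfold_path s l ` ?H l)"
    then show "p \<in> symmetric_dyck_paths s ?K"
      using unfold_path_in_symmetric[OF assms, of _ ?K] by auto
  qed
  moreover have "card (\<Union>l\<in>{0..2 * k}. unfold_path s l ` ?H l) =
      (\<Sum>l = 0..2 * k. card (unfold_path s l ` ?H l))"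
    by (intro card_UN_disjoint ballI impI) (use H(1) unfold_path_inject in blast)+
  moreover have "card (unfold_path s l ` ?H l) = card (?H l)" for l
    by (intro card_image inj_onI) (use unfold_path_inject in blast)
  ultimately show ?thesis
    using H(2) by simp
qed

subsection \<open>Profiles\<close>

definition window_bounded :: "nat \<Rightarrow> int list \<Rightarrow> bool" where
  "window_bounded K g \<longleftrightarrow>
     (\<forall>i j. i < j \<longrightarrow> j < length g \<longrightarrow> j \<le> i + K \<longrightarrow> g ! j \<le> g ! i + 1)"

text \<open>With s = 2m+1, a symmetric set S closed under subtraction of s, ..., s+2k+1 consists of all s q + r
  with q \<le> Q r. The profile of S is Q shifted by one in argument and value, so that Q m = -1 becomes
  the final zero; its initial entry is replaced by 0, which encodes the condition imposed by the
  symmetry about -1/2. The bound on the last entries encodes the symmetry about the other centre.\<close>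

definition profiles :: "nat \<Rightarrow> nat \<Rightarrow> int list set" where
  "profiles k c = {g. length g = Suc c \<and> window_bounded (2 * k + 1) g \<and> g ! c = 0 \<and>
     (\<forall>i\<le>c. c \<le> i + k \<longrightarrow> 0 \<le> g ! i)}"

text \<open>Climbing by at most 1 per column must end at 0. This bound provides the base case for
  inductions on the initial value.\<close>

lemma profile_hd_ge:
  assumes "g \<in> profiles k c"
  shows "- int c \<le> g ! 0"
proof -
  have len: "length g = Suc c" and wb: "window_bounded (2 * k + 1) g" and "g ! c = 0"
    using assms by (auto simp: profiles_def)
  have "g ! i \<le> g ! 0 + int i" if "i \<le> c" for i
    using that
  proof (induction i)
    case (Suc i)
    have "g ! Suc i \<le> g ! i + 1"
      using wb Suc.prems len by (auto simp: window_bounded_def)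
    then show ?case using Suc by simp
  qed simp
  from this[of c] \<open>g ! c = 0\<close> show ?thesis by simp
qed

definition raise_start :: "int \<Rightarrow> nat \<Rightarrow> int list \<Rightarrow> int list" where
  "raise_start q l g = q # replicate (l - 1) (q + 1) @ g"

lemma length_raise_start: "0 < l \<Longrightarrow> length (raise_start q l g) = l + length g"
  by (simp add: raise_start_def)

lemma nth_raise_start:
  "0 < l \<Longrightarrow> raise_start q l g ! i = (if i = 0 then q else if i < l then q + 1 else g ! (i - l))"
  by (auto simp: raise_start_def nth_Cons nth_append split: nat.splits)

lemma raise_start_in_profiles:
  assumes g: "g \<in> profiles k (c - l)" and l: "0 < l" "l \<le> c" "l \<le> 2 * k + 1"
    and hd: "g ! 0 \<le> q + of_bool (l = 2 * k + 1)"
  shows "raise_start q l g \<in> profiles k c"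
proof -
  from g have len: "length g = Suc (c - l)" and wb: "window_bounded (2 * k + 1) g"
    and lst: "g ! (c - l) = 0" and fin: "\<And>i. i \<le> c - l \<Longrightarrow> c - l \<le> i + k \<Longrightarrow> 0 \<le> g ! i"
    by (auto simp: profiles_def)
  have near: "g ! i \<le> g ! 0 + 1" if "i \<le> c - l" "i \<le> 2 * k + 1" for i
    using wb that len by (cases "i = 0") (auto simp: window_bounded_def)
  have "window_bounded (2 * k + 1) (raise_start q l g)"
    unfolding window_bounded_def
  proof (intro allI impI)
    fix i j assume ij: "i < j" "j < length (raise_start q l g)" "j \<le> i + (2 * k + 1)"
    then have j: "j \<le> c" using len l by (simp add: length_raise_start)
    consider "j < l" | "l \<le> j" "i < l" | "l \<le> i" by linarith
    then show "raise_start q l g ! j \<le> raise_start q l g ! i + 1"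
    proof cases
      case 1
      then show ?thesis using ij l by (auto simp: nth_raise_start)
    next
      case 2
      have "g ! (j - l) \<le> g ! 0 + 1"
        by (rule near) (use ij j 2 in auto)
      \<comment> \<open>For l = 2k+1 the window of position 0 reaches only the first entry of g, the
        one entry that \<open>hd\<close> bounds by q + 1.\<close>
      moreover have "g ! (j - l) \<le> q + 1" if "l = 2 * k + 1" "i = 0"
        using that ij 2 hd by simp
      ultimately show ?thesis
        using 2 l hd by (cases "l = 2 * k + 1"; cases "i = 0") (simp_all add: nth_raise_start)
    next
      case 3
      then have "i - l < j - l" "j - l < length g" "j - l \<le> (i - l) + (2 * k + 1)"
        using ij j len by auto
      then have "g ! (j - l) \<le> g ! (i - l) + 1"
        using wb unfolding window_bounded_def by blast
      then show ?thesis using 3 ij l by (auto simp: nth_raise_start)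
    qed
  qed
  moreover have "0 \<le> raise_start q l g ! i" if "i \<le> c" "c \<le> i + k" for i
  proof (cases "i < l")
    case True
    \<comment> \<open>This gives q \<ge> 0 unless l = 2k+1. In that case only q \<ge> -1 follows,
      but c \<ge> l > k rules out i = 0, and the other entries before l are q + 1.\<close>
    then have "0 \<le> g ! 0" using fin[of 0] that by auto
    then show ?thesis using hd True that l by (auto simp: nth_raise_start of_bool_def split: if_splits)
  next
    case False
    then show ?thesis using fin[of "i - l"] that l by (auto simp: nth_raise_start)
  qed
  ultimately show ?thesis
    using len l lst by (auto simp: profiles_def length_raise_start nth_raise_start)
qed

lemma drop_profile:
  assumes "g \<in> profiles k c" "l \<le> c"
  shows "drop l g \<in> profiles k (c - l)"
proof -
  have "drop l g ! j \<le> drop l g ! i + 1"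
    if "i < j" "j < length (drop l g)" "j \<le> i + (2 * k + 1)" for i j
    using assms that by (auto simp: profiles_def window_bounded_def)
  then show ?thesis
    using assms by (auto simp: profiles_def window_bounded_def)
qed

text \<open>A profile is cut at the first later position where it does not exceed its initial value q, or
  after K steps if there is none; between the two positions it is constantly q + 1.\<close>

lemma profiles_starting_at:
  "{g \<in> profiles k c. g ! 0 = q} =
     (\<Union>l\<in>{1..min c (2 * k + 1)}.
        raise_start q l ` {g \<in> profiles k (c - l). g ! 0 \<le> q + of_bool (l = 2 * k + 1)}) \<union>
     {g. g = q # replicate c (q + 1) \<and> (c = 0 \<and> q = 0 \<or> q = -1 \<and> k < c \<and> c \<le> 2 * k)}"
  (is "?L = ?U \<union> ?T")
proof (intro equalityI subsetI)
  fix g assume "g \<in> ?L"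
  then have g: "g \<in> profiles k c" and hd: "g ! 0 = q" and len: "length g = Suc c"
    and lst: "g ! c = 0"
    by (auto simp: profiles_def)
  have le: "g ! i \<le> q + 1" if "i \<le> c" "i \<le> 2 * k + 1" for i
    using g that hd by (cases "i = 0") (auto simp: profiles_def window_bounded_def)
  define cut where "cut l \<longleftrightarrow> l \<in> {1..min c (2 * k + 1)} \<and> (g ! l \<le> q \<or> l = 2 * k + 1)" for l
  show "g \<in> ?U \<union> ?T"
  proof (cases "\<exists>l. cut l")
    case True
    define l where "l = (LEAST l. cut l)"
    have l: "cut l" unfolding l_def using True by (rule LeastI_ex)
    have *: "g ! i = q + 1" if "0 < i" "i < l" for i
    proof -
      have "\<not> cut i" using that(2) unfolding l_def by (rule not_less_Least)
      then show ?thesis using that l le[of i] by (auto simp: cut_def)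
    qed
    have "g = raise_start q l (drop l g)"
    proof (rule nth_equalityI)
      show "length g = length (raise_start q l (drop l g))"
        using l len by (auto simp: cut_def length_raise_start)
      show "g ! i = raise_start q l (drop l g) ! i" if "i < length g" for i
        using l len hd * that by (auto simp: cut_def nth_raise_start)
    qed
    moreover have "drop l g ! 0 \<le> q + of_bool (l = 2 * k + 1)"
      using l len le[of l] by (auto simp: cut_def)
    moreover have "drop l g \<in> profiles k (c - l)"
      using drop_profile[OF g] l by (auto simp: cut_def)
    moreover have "l \<in> {1..min c (2 * k + 1)}" using l by (simp add: cut_def)
    ultimately show ?thesis by blast
  next
    case False
    then have "\<not> cut (2 * k + 1)" by blast
    then have c: "c < 2 * k + 1" by (auto simp: cut_def)
    have *: "g ! i = q + 1" if "0 < i" "i \<le> c" for i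
    proof -
      have "\<not> cut i" using False by blast
      then show ?thesis using that c le[of i] by (auto simp: cut_def)
    qed
    have "g = q # replicate c (q + 1)"
      by (rule nth_equalityI) (use len hd * in \<open>auto simp: nth_Cons split: nat.splits\<close>)
    \<comment> \<open>Without a cut, the final zero lies on the plateau, so q + 1 = 0. The entries
      within k of the end are nonnegative, so the initial -1 must be farther away.\<close>
    moreover have "c = 0 \<and> q = 0 \<or> q = -1 \<and> k < c \<and> c \<le> 2 * k"
    proof (cases "c = 0")
      case True
      then show ?thesis using lst hd by simp
    next
      case False
      then have "q = -1" using *[of c] lst by simp
      moreover have "k < c" using g hd \<open>q = -1\<close> by (force simp: profiles_def)
      ultimately show ?thesis using c by simp
    qed
    ultimately show ?thesis by simp
  qed
next
  fix g assume "g \<in> ?U \<union> ?T"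
  then show "g \<in> ?L"
  proof
    assume "g \<in> ?U"
    then show ?thesis
      using raise_start_in_profiles[of _ k c _ q] by (auto simp: nth_raise_start)
  next
    assume "g \<in> ?T"
    then have g: "g = q # replicate c (q + 1)"
      and c: "c = 0 \<and> q = 0 \<or> q = -1 \<and> k < c \<and> c \<le> 2 * k"
      by simp_all
    have nth: "g ! i = (if i = 0 then q else q + 1)" if "i \<le> c" for i
      using that unfolding g by (cases i) auto
    have "window_bounded (2 * k + 1) g"
      unfolding window_bounded_def by (auto simp: g nth[unfolded g])
    then show ?thesis
      using c nth[of 0] nth[of c] nth by (auto simp: g profiles_def)
  qed
qed

lemma profiles_below_eq_empty: "q < - int c \<Longrightarrow> {g \<in> profiles k c. g ! 0 \<le> q} = {}"
  using profile_hd_ge by fastforce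

text \<open>The cut position can be read off the list: for l < l' \<le> 2k+1, the entry at l is at
  most q if the cut is at l and equals q + 1 if it is at l'.\<close>

lemma card_profiles_rec:
  assumes fin: "\<And>c q. finite {g \<in> profiles k c. g ! 0 \<le> q}"
  shows "card {g \<in> profiles k c. g ! 0 \<le> q} = card {g \<in> profiles k c. g ! 0 \<le> q - 1} +
    (\<Sum>l = 1..min c (2 * k + 1).
       card {g \<in> profiles k (c - l). g ! 0 \<le> q + of_bool (l = 2 * k + 1)}) +
    of_bool (c = 0 \<and> q = 0) + of_bool (q = -1 \<and> k < c \<and> c \<le> 2 * k)"
proof -
  let ?E = "\<lambda>l. {g \<in> profiles k (c - l). g ! 0 \<le> q + of_bool (l = 2 * k + 1)}"
  let ?U = "\<Union>l\<in>{1..min c (2 * k + 1)}. raise_start q l ` ?E l"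
  let ?T = "{g. g = q # replicate c (q + 1) \<and>
    (c = 0 \<and> q = 0 \<or> q = -1 \<and> k < c \<and> c \<le> 2 * k)}"
  have T: "card ?T = of_bool (c = 0 \<and> q = 0) + of_bool (q = -1 \<and> k < c \<and> c \<le> 2 * k)"
    and finT: "finite ?T"
    by (auto simp: of_bool_def)
  have neq: "raise_start q l g \<noteq> raise_start q l' g'"
    if "l < l'" "0 < l" "l' \<le> 2 * k + 1" "g \<in> ?E l" for l l' g g'
  proof
    assume "raise_start q l g = raise_start q l' g'"
    then have "raise_start q l g ! l = raise_start q l' g' ! l" by simp
    then show False using that by (simp add: nth_raise_start)
  qed
  have disjoint_images: "f ` A \<inter> f' ` B = {}"
    if "\<And>a b. a \<in> A \<Longrightarrow> b \<in> B \<Longrightarrow> f a \<noteq> f' b"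
    for f f' :: "int list \<Rightarrow> int list" and A B
    using that by blast
  have "card ?U = (\<Sum>l = 1..min c (2 * k + 1). card (raise_start q l ` ?E l))"
  proof (intro card_UN_disjoint ballI impI)
    fix l l' assume l: "l \<in> {1..min c (2 * k + 1)}" "l' \<in> {1..min c (2 * k + 1)}" "l \<noteq> l'"
    have "raise_start q l g \<noteq> raise_start q l' g'" if g: "g \<in> ?E l" "g' \<in> ?E l'" for g g'
    proof (cases "l < l'")
      case True
      show ?thesis by (rule neq[OF True _ _ g(1)]) (use l in auto)
    next
      case False
      then have "l' < l" using l(3) by simp
      have "raise_start q l' g' \<noteq> raise_start q l g"
        by (rule neq[OF \<open>l' < l\<close> _ _ g(2)]) (use l in auto)
      then show ?thesis by (rule not_sym)
    qed
    then show "raise_start q l ` ?E l \<inter> raise_start q l' ` ?E l' = {}"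
      by (rule disjoint_images)
  qed (use fin in auto)
  moreover have "card (raise_start q l ` ?E l) = card (?E l)" for l
    by (intro card_image) (auto simp: inj_on_def raise_start_def)
  moreover have finU: "finite ?U"
    using fin by auto
  moreover have "?U \<inter> ?T = {}"
  proof -
    have False if l: "l \<in> {1..min c (2 * k + 1)}" and g: "g \<in> ?E l"
      and eq: "raise_start q l g = q # replicate c (q + 1)"
      and c: "c = 0 \<and> q = 0 \<or> q = -1 \<and> k < c \<and> c \<le> 2 * k" for l g
    proof -
      have "raise_start q l g ! l = (q # replicate c (q + 1)) ! l" using eq by simp
      then show False using l g c by (cases l) (auto simp: nth_raise_start split: if_splits)
    qed
    then show ?thesis by blast
  qed
  ultimately have card: "card (?U \<union> ?T) = (\<Sum>l = 1..min c (2 * k + 1). card (?E l)) +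
      (of_bool (c = 0 \<and> q = 0) + of_bool (q = -1 \<and> k < c \<and> c \<le> 2 * k))"
    using T finT by (simp only: card_Un_disjoint)
  have "{g \<in> profiles k c. g ! 0 \<le> q} =
      {g \<in> profiles k c. g ! 0 \<le> q - 1} \<union> {g \<in> profiles k c. g ! 0 = q}"
    by auto
  then have "card {g \<in> profiles k c. g ! 0 \<le> q} =
      card ({g \<in> profiles k c. g ! 0 \<le> q - 1} \<union> {g \<in> profiles k c. g ! 0 = q})"
    by (rule arg_cong)
  also have "\<dots> = card {g \<in> profiles k c. g ! 0 \<le> q - 1} + card {g \<in> profiles k c. g ! 0 = q}"
  proof (rule card_Un_disjoint)
    show "finite {g \<in> profiles k c. g ! 0 = q}"
      unfolding profiles_starting_at using finU finT by (rule finite_UnI)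
  qed (rule fin, auto)
  also have "card {g \<in> profiles k c. g ! 0 = q} = card (?U \<union> ?T)"
    unfolding profiles_starting_at ..
  finally show ?thesis
    unfolding card by (simp only: add.assoc)
qed

lemma finite_profiles: "finite {g \<in> profiles k c. g ! 0 \<le> q}"
proof (induction c arbitrary: q rule: less_induct)
  case (less c)
  have "finite {g \<in> profiles k c. g ! 0 \<le> - int c - 1 + int n}" for n
  proof (induction n)
    case 0
    have "{g \<in> profiles k c. g ! 0 \<le> - int c - 1} = {}"
      by (rule profiles_below_eq_empty) simp
    then show ?case by (simp only: of_nat_0 add_0_right finite.emptyI)
  next
    case (Suc n)
    let ?q = "- int c - 1 + int (Suc n)"
    have "{g \<in> profiles k c. g ! 0 \<le> ?q} =
        {g \<in> profiles k c. g ! 0 \<le> - int c - 1 + int n} \<union> {g \<in> profiles k c. g ! 0 = ?q}"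
      by auto
    moreover have "finite {g \<in> profiles k c. g ! 0 = ?q}"
      unfolding profiles_starting_at using less by auto
    ultimately show ?case using Suc by simp
  qed
  from this[of "nat (q + int c + 1)"] show ?case
    by (cases "q < - int c") (simp_all add: profiles_below_eq_empty)
qed

text \<open>A profile is a walk read column by column, where the starting value may be lowered by down steps.
  The first term counts the profiles whose last cut is at the final column, the sum those that end in
  a plateau of length j.\<close>

definition profile_count :: "nat \<Rightarrow> int \<Rightarrow> int \<Rightarrow> int" where
  "profile_count k c q = walks k (2 * c + (2 * int k + 1) * q) (- q) +
     (\<Sum>j = k + 1..2 * k. walks k (2 * (c - int j) + (2 * int k + 1) * (q + 1)) (- (q + 1)))"

text \<open>After the shear, these are positions too steep for any walk; in the sum, j \<ge> 1
  offsets the change from q to q + 1.\<close>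

lemma profile_count_eq_0:
  assumes "c < 0 \<or> q < - c"
  shows "profile_count k c q = 0"
proof -
  have *: "walks k (2 * c + (2 * int k + 1) * q) (- q) = 0" if "c < 0 \<or> q < - c" for c q
  proof (rule walks_eq_0_if_steep)
    have "0 \<le> 2 * int k * (\<bar>q\<bar> - q)"
      by (intro mult_nonneg_nonneg) auto
    moreover have "2 * c < \<bar>q\<bar> - q"
      using that by linarith
    moreover have "(2 * int k + 1) * \<bar>- q\<bar> =
        (2 * int k + 1) * q + 2 * int k * (\<bar>q\<bar> - q) + (\<bar>q\<bar> - q)"
      by (simp add: algebra_simps)
    ultimately show "2 * c + (2 * int k + 1) * q < (2 * int k + 1) * \<bar>- q\<bar>"
      by linarith
  qed
  have "walks k (2 * (c - int j) + (2 * int k + 1) * (q + 1)) (- (q + 1)) = 0"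
    if "j \<in> {k + 1..2 * k}" for j
    by (rule *) (use that assms in auto)
  then show ?thesis
    using *[OF assms] by (simp add: profile_count_def)
qed

lemma profile_count_rec:
  "profile_count k c q = profile_count k c (q - 1) +
     (\<Sum>l = 1..2 * k + 1. profile_count k (c - int l) (q + of_bool (l = 2 * k + 1))) +
     of_bool (c = 0 \<and> q = 0) + of_bool (q = -1 \<and> int k < c \<and> c \<le> 2 * int k)"
proof -
  let ?K = "2 * int k + 1"
  define w where "w c q = walks k (2 * c + ?K * q) (- q)" for c q
  have pc: "profile_count k c q = w c q + (\<Sum>j = k + 1..2 * k. w (c - int j) (q + 1))" for c q
    by (simp add: profile_count_def w_def)
  \<comment> \<open>A horizontal first step lowers c by l, an up step leads from (c, q) to (c - K, q
    + 1) and a down step to (c, q - 1).\<close>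
  have w: "w c q = of_bool (c = 0 \<and> q = 0) + (\<Sum>l = 1..2 * k. w (c - int l) q) +
      w (c - ?K) (q + 1) + w c (q - 1)" for c q
  proof -
    have "- q - 1 = - (q + 1)" "- q + 1 = - (q - 1)"
      and "2 * c + ?K * q - ?K = 2 * (c - ?K) + ?K * (q + 1)"
      and "2 * (c - ?K) + ?K * (q + 1) = 2 * c + ?K * (q - 1)"
      and "2 * c + ?K * q - 2 * int l = 2 * (c - int l) + ?K * q" for l
      by (simp_all add: algebra_simps)
    moreover have "2 * c + ?K * q = 0 \<and> - q = 0 \<longleftrightarrow> c = 0 \<and> q = 0"
      by auto
    ultimately show ?thesis
      unfolding w_def by (subst walks_rec) (simp only:)
  qed
  have "(\<Sum>j = k + 1..2 * k. w (c - int j) (q + 1)) =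
      (\<Sum>j = k + 1..2 * k. of_bool (c - int j = 0 \<and> q + 1 = 0)) +
      (\<Sum>j = k + 1..2 * k. \<Sum>l = 1..2 * k. w (c - int j - int l) (q + 1)) +
      (\<Sum>j = k + 1..2 * k. w (c - int j - ?K) (2 + q)) +
      (\<Sum>j = k + 1..2 * k. w (c - int j) q)"
    by (subst w) (simp add: sum.distrib)
  also have "(\<Sum>j = k + 1..2 * k. \<Sum>l = 1..2 * k. w (c - int j - int l) (q + 1)) =
      (\<Sum>l = 1..2 * k. \<Sum>j = k + 1..2 * k. w (c - int l - int j) (q + 1))"
    by (subst sum.swap) (simp add: algebra_simps)
  \<comment> \<open>The empty walk occurs only in the summand j = c, which is the profile consisting
    of one uncut plateau.\<close>
  also have "(\<Sum>j = k + 1..2 * k. of_bool (c - int j = 0 \<and> q + 1 = 0)) =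
      (of_bool (q = -1 \<and> int k < c \<and> c \<le> 2 * int k) :: int)"
  proof (cases "q = -1 \<and> int k < c \<and> c \<le> 2 * int k")
    case True
    then have "(c - int j = 0 \<and> q + 1 = 0) \<longleftrightarrow> j = nat c" for j by auto
    then show ?thesis using True by (auto simp: of_bool_def)
  next
    case False
    then show ?thesis by (auto simp: of_bool_def intro!: sum.neutral)
  qed
  finally have s: "(\<Sum>j = k + 1..2 * k. w (c - int j) (q + 1)) =
      of_bool (q = -1 \<and> int k < c \<and> c \<le> 2 * int k) +
      (\<Sum>l = 1..2 * k. \<Sum>j = k + 1..2 * k. w (c - int l - int j) (q + 1)) +
      (\<Sum>j = k + 1..2 * k. w (c - int j - ?K) (2 + q)) +
      (\<Sum>j = k + 1..2 * k. w (c - int j) q)" .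
  have "(\<Sum>l = 1..2 * k + 1. profile_count k (c - int l) (q + of_bool (l = 2 * k + 1))) =
      (\<Sum>l = 1..2 * k. profile_count k (c - int l) q) + profile_count k (c - ?K) (q + 1)"
    by (simp add: algebra_simps)
  also have "(\<Sum>l = 1..2 * k. profile_count k (c - int l) q) = (\<Sum>l = 1..2 * k. w (c - int l) q) +
      (\<Sum>l = 1..2 * k. \<Sum>j = k + 1..2 * k. w (c - int l - int j) (q + 1))"
    by (simp add: pc sum.distrib)
  also have "profile_count k (c - ?K) (q + 1) =
      w (c - ?K) (q + 1) + (\<Sum>j = k + 1..2 * k. w (c - int j - ?K) (2 + q))"
    by (simp add: pc algebra_simps)
  finally have pc_sum: "(\<Sum>l = 1..2 * k + 1. profile_count k (c - int l) (q + of_bool (l = 2 * k + 1))) =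
      (\<Sum>l = 1..2 * k. w (c - int l) q) +
      (\<Sum>l = 1..2 * k. \<Sum>j = k + 1..2 * k. w (c - int l - int j) (q + 1)) +
      (w (c - ?K) (q + 1) + (\<Sum>j = k + 1..2 * k. w (c - int j - ?K) (2 + q)))" .
  have "profile_count k c (q - 1) = w c (q - 1) + (\<Sum>j = k + 1..2 * k. w (c - int j) q)"
    by (simp add: pc)
  then show ?thesis
    using pc_sum s w[of c q] pc[of c q] by linarith
qed

text \<open>Both sides obey the same recursion. It refers to the same c only with q - 1, and to
  larger values only with smaller c, so induction on c is combined with a climb in q from -c-1,
  where both sides vanish.\<close>

lemma card_profiles_le: "int (card {g \<in> profiles k c. g ! 0 \<le> q}) = profile_count k (int c) q"
proof (induction c arbitrary: q rule: less_induct)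
  case (less c)
  let ?K = "2 * k + 1"
  have step: "int (card {g \<in> profiles k c. g ! 0 \<le> q}) = profile_count k (int c) q"
    if IH: "int (card {g \<in> profiles k c. g ! 0 \<le> q - 1}) = profile_count k (int c) (q - 1)" for q
  proof -
    let ?f = "\<lambda>l. profile_count k (int c - int l) (q + of_bool (l = ?K))"
    let ?g = "\<lambda>l. card {g \<in> profiles k (c - l). g ! 0 \<le> q + of_bool (l = ?K)}"
    have "(\<Sum>l = 1..?K. ?f l) = (\<Sum>l = 1..min c ?K. ?f l)"
      by (rule sum.mono_neutral_right) (auto intro: profile_count_eq_0)
    also have "\<dots> = (\<Sum>l = 1..min c ?K. int (?g l))"
      by (rule sum.cong) (auto simp: less of_nat_diff)
    finally have "(\<Sum>l = 1..?K. ?f l) = int (\<Sum>l = 1..min c ?K. ?g l)"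
      by simp
    then show ?thesis
      unfolding card_profiles_rec[OF finite_profiles, of k c q] profile_count_rec[of k "int c" q]
        of_nat_add IH
      using of_nat_le_iff[of c "2 * k", where ?'a = int] by simp
  qed
  have "int (card {g \<in> profiles k c. g ! 0 \<le> - int c - 1 + int n}) =
      profile_count k (int c) (- int c - 1 + int n)" for n
  proof (induction n)
    case 0
    have "{g \<in> profiles k c. g ! 0 \<le> - int c - 1} = {}"
      by (rule profiles_below_eq_empty) simp
    moreover have "profile_count k (int c) (- int c - 1) = 0"
      by (rule profile_count_eq_0) simp
    ultimately show ?case by (simp only: of_nat_0 add_0_right card.empty)
  next
    case (Suc n)
    then show ?case
      using step[of "- int c - 1 + int (Suc n)"] by (simp only: of_nat_Suc) (simp add: algebra_simps)
  qed
  from this[of "nat (q + int c + 1)"] show ?case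
    by (cases "q < - int c") (simp_all add: profiles_below_eq_empty profile_count_eq_0)
qed

lemma sum_split_parity:
  fixes f :: "nat \<Rightarrow> 'a :: comm_monoid_add"
  shows "(\<Sum>l = 0..2 * k. f l) = (\<Sum>i = 0..k. f (2 * i)) + (\<Sum>i = 1..k. f (2 * i - 1))"
  by (induction k) (simp_all add: ac_simps)

text \<open>Expanding \<open>walks k (2 * ?M) 0\<close> by its first step cancels everything
  subtracted for q = -1: the down-step term, and the horizontal terms with l > k. Parity then
  matches even l with net height -1 and odd l with net height 0.\<close>

lemma card_profiles:
  "int (card {g \<in> profiles k (m + 1). g ! 0 = 0}) =
    (\<Sum>l = 0..2 * k. walks k (2 * int m + 1 - int l) (-1) + walks k (2 * int m + 1 - int l) 0)"
proof -
  let ?E = "\<lambda>q. {g \<in> profiles k (m + 1). g ! 0 \<le> q}"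
  let ?M = "int m + 1"
  have ins: "{0..k} = insert k {0..<k}"
    by auto
  have "{g \<in> profiles k (m + 1). g ! 0 = 0} = ?E 0 - ?E (-1)"
    by auto
  then have "int (card {g \<in> profiles k (m + 1). g ! 0 = 0}) = int (card (?E 0 - ?E (-1)))"
    by (rule arg_cong)
  also have "card (?E 0 - ?E (-1)) = card (?E 0) - card (?E (-1))"
    by (rule card_Diff_subset) (rule finite_profiles, auto)
  also have "int \<dots> = int (card (?E 0)) - int (card (?E (-1)))"
    by (intro of_nat_diff card_mono finite_profiles) auto
  also have "\<dots> = profile_count k ?M 0 - profile_count k ?M (-1)"
    unfolding card_profiles_le by (simp only: of_nat_add of_nat_1)
  also have "\<dots> = walks k (2 * ?M) 0
      + (\<Sum>j = k + 1..2 * k. walks k (2 * (?M - int j) + (2 * int k + 1)) (-1))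
      - walks k (2 * ?M - (2 * int k + 1)) 1 - (\<Sum>j = k + 1..2 * k. walks k (2 * (?M - int j)) 0)"
    by (simp add: profile_count_def)
  also have "walks k (2 * ?M) 0 = (\<Sum>l = 1..2 * k. walks k (2 * (?M - int l)) 0) +
      walks k (2 * ?M - (2 * int k + 1)) (-1) + walks k (2 * ?M - (2 * int k + 1)) 1"
    by (subst walks_rec) (simp add: algebra_simps)
  also have "(\<Sum>l = 1..2 * k. walks k (2 * (?M - int l)) 0) =
      (\<Sum>l = 1..k. walks k (2 * (?M - int l)) 0) + (\<Sum>l = k + 1..2 * k. walks k (2 * (?M - int l)) 0)"
    by (subst sum.union_disjoint[symmetric]) (auto intro!: sum.cong)
  also have "(\<Sum>j = k + 1..2 * k. walks k (2 * (?M - int j) + (2 * int k + 1)) (-1)) =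
      (\<Sum>i\<in>{0..<k}. walks k (2 * int m + 1 - int (2 * i)) (-1))"
    by (rule sum.reindex_bij_witness[of _ "\<lambda>i. i + k + 1" "\<lambda>j. j - k - 1"])
      (auto simp: algebra_simps of_nat_diff)
  \<comment> \<open>The plateaus give i < k; the remaining i = k is the up-step term, as 2(m+1) -
    (2k+1) = 2m+1-2k.\<close>
  finally have "int (card {g \<in> profiles k (m + 1). g ! 0 = 0}) =
      (\<Sum>i = 0..k. walks k (2 * int m + 1 - int (2 * i)) (-1)) +
      (\<Sum>i = 1..k. walks k (2 * (?M - int i)) 0)"
    by (simp add: ins algebra_simps)
  also have "(\<Sum>i = 0..k. walks k (2 * int m + 1 - int (2 * i)) (-1)) =
      (\<Sum>l = 0..2 * k. walks k (2 * int m + 1 - int l) (-1))"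
  proof -
    have "(\<Sum>i = 1..k. walks k (2 * int m + 1 - int (2 * i - 1)) (-1)) = 0"
      by (intro sum.neutral ballI walks_eq_0_if_parity) (auto simp: of_nat_diff)
    then show ?thesis by (simp add: sum_split_parity)
  qed
  also have "(\<Sum>i = 1..k. walks k (2 * (?M - int i)) 0) =
      (\<Sum>l = 0..2 * k. walks k (2 * int m + 1 - int l) 0)"
  proof -
    have "(\<Sum>i = 0..k. walks k (2 * int m + 1 - int (2 * i)) 0) = 0"
      by (intro sum.neutral ballI walks_eq_0_if_parity) auto
    moreover have "(\<Sum>i = 1..k. walks k (2 * int m + 1 - int (2 * i - 1)) 0) =
        (\<Sum>i = 1..k. walks k (2 * (?M - int i)) 0)"
      by (intro sum.cong refl arg_cong2[of _ _ _ _ "walks k"]) (auto simp: of_nat_diff)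
    ultimately show ?thesis by (simp add: sum_split_parity)
  qed
  finally show ?thesis by (simp add: sum.distrib)
qed

subsection \<open>Bead sets and profiles\<close>

lemma int_downset_has_maximum:
  fixes P :: "int \<Rightarrow> bool"
  assumes down: "\<And>q. P (q + 1) \<Longrightarrow> P q" and "P a" "\<not> P b"
  shows "\<exists>c. \<forall>q. P q \<longleftrightarrow> q \<le> c"
proof -
  have down': "P q" if "P (q + int n)" for q n
    using that
  proof (induction n)
    case (Suc n)
    then show ?case using down[of "q + int n"] by (simp add: ac_simps)
  qed simp
  have le: "P q" if "P q'" "q \<le> q'" for q q'
    using down'[of q "nat (q' - q)"] that by simp
  have "a < b"
    using le[of a b] assms by force
  then have ex: "\<not> P (a + int (nat (b - a)))"
    using assms by simp
  define n where "n = (LEAST n. \<not> P (a + int n))"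
  have n: "\<not> P (a + int n)"
    unfolding n_def by (rule LeastI[of "\<lambda>n. \<not> P (a + int n)"]) (rule ex)
  then obtain n' where n': "n = Suc n'"
    using \<open>P a\<close> by (cases n) auto
  have "P (a + int n')"
    using not_less_Least[of n' "\<lambda>n. \<not> P (a + int n)"] n' unfolding n_def by simp
  moreover have "\<not> P (a + int n' + 1)"
    using n n' by (simp add: ac_simps)
  ultimately have "P q \<longleftrightarrow> q \<le> a + int n'" for q
    using le[of "a + int n'" q] le[of q "a + int n' + 1"] le[of "a + int n' + 1" q] by force
  then show ?thesis by blast
qed

text \<open>The maximum Q r recovered from the profile; beyond m it is forced by Q (2m - r) = -2 - Q r.\<close>

definition level :: "nat \<Rightarrow> int list \<Rightarrow> int \<Rightarrow> int" where
  "level m g r =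
     (if r \<le> int m then g ! nat (r + 1) - 1 else - 1 - g ! nat (2 * int m + 1 - r))"

definition bead_set :: "nat \<Rightarrow> int list \<Rightarrow> int set" where
  "bead_set m g = {n. n div (2 * int m + 1) \<le> level m g (n mod (2 * int m + 1))}"

lemma bead_set_iff:
  assumes "0 \<le> r" "r \<le> 2 * int m"
  shows "(2 * int m + 1) * q + r \<in> bead_set m g \<longleftrightarrow> q \<le> level m g r"
proof -
  have "((2 * int m + 1) * q + r) div (2 * int m + 1) = q"
    by (rule int_div_pos_eq) (use assms in auto)
  moreover have "((2 * int m + 1) * q + r) mod (2 * int m + 1) = r"
    by (rule int_mod_pos_eq) (use assms in auto)
  ultimately show ?thesis by (simp add: bead_set_def)
qed

lemma division_by_odd:
  fixes n :: int
  obtains q r where "n = (2 * int m + 1) * q + r" "0 \<le> r" "r \<le> 2 * int m"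
proof
  show "n = (2 * int m + 1) * (n div (2 * int m + 1)) + n mod (2 * int m + 1)"
    by simp
  show "n mod (2 * int m + 1) \<le> 2 * int m"
    using pos_mod_bound[of "2 * int m + 1" n] by linarith
qed simp

text \<open>A profile records only windows left of the centre m. Those across m are controlled by
  the nonnegative last entries, and those that wrap around to the next period by the initial
  0.\<close>

lemma bead_set_symmetric:
  assumes "g \<in> profiles k (m + 1)" "g ! 0 = 0"
  shows "bead_set m g \<in> symmetric_bead_sets {2 * m + 1..2 * m + 2 * k + 2}"
proof -
  let ?s = "2 * int m + 1"
  define h where "h i = g ! nat i" for i
  have len: "length g = m + 2" and wb: "window_bounded (2 * k + 1) g" and "g ! (m + 1) = 0"
    and nonneg: "\<And>i. i \<le> m + 1 \<Longrightarrow> m + 1 \<le> i + k \<Longrightarrow> 0 \<le> g ! i"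
    using assms by (auto simp: profiles_def)
  have h0: "h 0 = 0"
    using assms by (simp add: h_def)
  have "nat (int m + 1) = m + 1" by simp
  then have hM: "h (int m + 1) = 0"
    using \<open>g ! (m + 1) = 0\<close> unfolding h_def by (simp only:)
  have window: "h j \<le> h i + 1" if "0 \<le> i" "i \<le> j" "j \<le> int m + 1" "j \<le> i + 2 * int k + 1" for i j
  proof (cases "i = j")
    case False
    have "g ! nat j \<le> g ! nat i + 1"
      using wb[unfolded window_bounded_def, rule_format, of "nat i" "nat j"] that False len by auto
    then show ?thesis by (simp add: h_def)
  qed simp
  have start: "h i \<le> 1" if "0 \<le> i" "i \<le> int m + 1" "i \<le> 2 * int k + 1" for i
    using window[of 0 i] that h0 by simp
  have end_far: "-1 \<le> h i" if "0 \<le> i" "i \<le> int m + 1" "int m + 1 \<le> i + 2 * int k + 1" for i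
    using window[of i "int m + 1"] that hM by simp
  have end_near: "0 \<le> h i" if "0 \<le> i" "i \<le> int m + 1" "int m + 1 \<le> i + int k" for i
    unfolding h_def by (rule nonneg) (use that in auto)
  have lev: "level m g r = (if r \<le> int m then h (r + 1) - 1 else - 1 - h (2 * int m + 1 - r))" for r
    by (simp add: level_def h_def)
  have level_sym: "level m g (2 * int m - r) = - 2 - level m g r" for r
  proof -
    consider "r < int m" | "r = int m" | "int m < r" by linarith
    then show ?thesis
      by cases (use hM in \<open>auto simp: lev algebra_simps\<close>)
  qed
  have level_down: "level m g r \<le> level m g r' + 1"
    if "0 \<le> r'" "r' \<le> r" "r \<le> 2 * int m" "r - r' \<le> 2 * int k + 1" for r r'
  proof -
    consider "r \<le> int m" | "int m < r'" | "r' \<le> int m" "int m < r" by linarith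
    then show ?thesis
    proof cases
      case 1
      then show ?thesis using window[of "r' + 1" "r + 1"] that by (simp add: lev)
    next
      case 2
      then show ?thesis
        using window[of "2 * int m + 1 - r" "2 * int m + 1 - r'"] that by (simp add: lev)
    next
      case 3
      have far: "-1 \<le> h (2 * int m + 1 - r)" "-1 \<le> h (r' + 1)"
        using 3 that by (auto intro!: end_far)
      \<comment> \<open>The positions r' \<le> m < r are at most 2k+1 apart, so one of them is
        within k of m.\<close>
      have "0 \<le> h (2 * int m + 1 - r) \<or> 0 \<le> h (r' + 1)"
      proof (cases "r \<le> int m + int k")
        case True
        then have "0 \<le> h (2 * int m + 1 - r)" by (intro end_near) (use 3 that in auto)
        then show ?thesis ..
      next
        case False
        then have "0 \<le> h (r' + 1)" by (intro end_near) (use 3 that in auto)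
        then show ?thesis ..
      qed
      then show ?thesis using 3 far by (auto simp: lev)
    qed
  qed
  have level_wrap: "level m g r \<le> level m g r' + 2"
    if "0 \<le> r" "r < r'" "r' \<le> 2 * int m" "r - r' + ?s \<le> 2 * int k + 1" for r r'
  proof -
    \<comment> \<open>Coarse bounds suffice, as wrapping allows a difference of 2: the initial 0
      gives \<open>start\<close>, the final 0 gives \<open>end_far\<close>.\<close>
    have "level m g r \<le> 0"
      using start[of "r + 1"] end_far[of "2 * int m + 1 - r"] that by (auto simp: lev)
    moreover have "-2 \<le> level m g r'"
      using start[of "2 * int m + 1 - r'"] end_far[of "r' + 1"] that by (auto simp: lev)
    ultimately show ?thesis by simp
  qed
  have short: "n - (?s + j) \<in> bead_set m g"
    if "n \<in> bead_set m g" "0 \<le> j" "j < ?s" "j \<le> 2 * int k + 1" for n j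
  proof -
    obtain q r where n: "n = ?s * q + r" "0 \<le> r" "r \<le> 2 * int m"
      by (rule division_by_odd)
    then have q: "q \<le> level m g r"
      using that by (simp add: bead_set_iff)
    show ?thesis
    proof (cases "j \<le> r")
      case True
      have eq: "n - (?s + j) = ?s * (q - 1) + (r - j)"
        using n by (simp add: algebra_simps)
      have "q - 1 \<le> level m g (r - j)"
        using level_down[of "r - j" r] q n that True by simp
      then show ?thesis
        unfolding eq by (subst bead_set_iff) (use n that True in auto)
    next
      case False
      have eq: "n - (?s + j) = ?s * (q - 2) + (r - j + ?s)"
        using n by (simp add: algebra_simps)
      have "q - 2 \<le> level m g (r - j + ?s)"
        using level_wrap[of r "r - j + ?s"] q n that False by simp
      then show ?thesis
        unfolding eq by (subst bead_set_iff) (use n that False in auto)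
    qed
  qed
  have closed: "n - (?s + int j) \<in> bead_set m g"
    if "n \<in> bead_set m g" "int j \<le> 2 * int k + 1" for n j
    using that
  proof (induction j rule: less_induct)
    case (less j)
    show ?case
    proof (cases "int j < ?s")
      case True
      then show ?thesis using short less.prems by simp
    next
      case False
      \<comment> \<open>If 2k+1 \<ge> s, larger shifts are composed of a shorter one and a further
        subtraction of s.\<close>
      then have "n - (?s + int (j - (2 * m + 1))) \<in> bead_set m g"
        by (intro less.IH) (use False less.prems in auto)
      then have "n - (?s + int (j - (2 * m + 1))) - (?s + 0) \<in> bead_set m g"
        by (rule short) auto
      then show ?thesis using False by (simp add: of_nat_diff algebra_simps)
    qed
  qed
  have "n \<in> bead_set m g \<longleftrightarrow> -1 - n \<notin> bead_set m g" for n
  proof -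
    obtain q r where n: "n = ?s * q + r" "0 \<le> r" "r \<le> 2 * int m"
      by (rule division_by_odd)
    have eq: "-1 - n = ?s * (- 1 - q) + (2 * int m - r)"
      using n by (simp add: algebra_simps)
    have "-1 - n \<in> bead_set m g \<longleftrightarrow> - 1 - q \<le> - 2 - level m g r"
      unfolding eq by (subst bead_set_iff) (use n in \<open>auto simp: level_sym\<close>)
    moreover have "n \<in> bead_set m g \<longleftrightarrow> q \<le> level m g r"
      using n by (simp add: bead_set_iff)
    ultimately show ?thesis by linarith
  qed
  moreover have "n - int t \<in> bead_set m g"
    if "t \<in> {2 * m + 1..2 * m + 2 * k + 2}" "n \<in> bead_set m g" for n t
  proof -
    have "int t = ?s + int (t - (2 * m + 1))" "int (t - (2 * m + 1)) \<le> 2 * int k + 1"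
      using that(1) by auto
    then show ?thesis using closed[OF that(2)] by metis
  qed
  ultimately show ?thesis
    unfolding symmetric_bead_sets_def by (intro CollectI conjI allI ballI)
qed

lemma inj_on_bead_set: "inj_on (bead_set m) {g \<in> profiles k (m + 1). g ! 0 = 0}"
proof (rule inj_onI)
  fix g g' assume g: "g \<in> {g \<in> profiles k (m + 1). g ! 0 = 0}"
    and g': "g' \<in> {g \<in> profiles k (m + 1). g ! 0 = 0}" and eq: "bead_set m g = bead_set m g'"
  show "g = g'"
  proof (rule nth_equalityI)
    show "length g = length g'" using g g' by (simp add: profiles_def)
    fix i assume "i < length g"
    show "g ! i = g' ! i"
    proof (cases i)
      case 0
      then show ?thesis using g g' by simp
    next
      case (Suc r)
      then have r: "r \<le> m" using \<open>i < length g\<close> g by (simp add: profiles_def)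
      then have "q \<le> level m g (int r) \<longleftrightarrow> q \<le> level m g' (int r)" for q
        using bead_set_iff[of "int r" m q g] bead_set_iff[of "int r" m q g'] eq by simp
      then have "level m g (int r) = level m g' (int r)"
        by (meson order_antisym order_refl)
      then show ?thesis using r Suc by (simp add: level_def nat_add_distrib)
    qed
  qed
qed

lemma symmetric_bead_set_realizable:
  assumes S: "S \<in> symmetric_bead_sets {2 * m + 1..2 * m + 2 * k + 2}"
  obtains g where "g \<in> profiles k (m + 1)" "g ! 0 = 0" "bead_set m g = S"
proof -
  let ?s = "2 * int m + 1"
  have sym: "n \<in> S \<longleftrightarrow> -1 - n \<notin> S" for n
    using S unfolding symmetric_bead_sets_def by (elim CollectE conjE allE)
  have shift: "\<forall>t\<in>{2 * m + 1..2 * m + 2 * k + 2}. \<forall>n\<in>S. n - int t \<in> S"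
    using S unfolding symmetric_bead_sets_def by (elim CollectE conjE)
  have closed: "n - (?s + j) \<in> S" if "n \<in> S" "0 \<le> j" "j \<le> 2 * int k + 1" for n j
  proof -
    have "2 * m + 1 + nat j \<in> {2 * m + 1..2 * m + 2 * k + 2}"
      using that by auto
    from bspec[OF bspec[OF shift this] that(1)]
    have "n - int (2 * m + 1 + nat j) \<in> S" .
    moreover have "n - int (2 * m + 1 + nat j) = n - (?s + j)"
      using that(2) by simp
    ultimately show ?thesis by (simp only:)
  qed
  have bounded: "n < ?s * ?s" if "n \<in> S" for n
    using symmetric_beads_bounded[OF S, of "2 * m + 1" n] that by (simp add: add.commute)
  have "\<exists>c. \<forall>q. ?s * q + r \<in> S \<longleftrightarrow> q \<le> c" for r
  proof (rule int_downset_has_maximum)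
    show "?s * q + r \<in> S" if "?s * (q + 1) + r \<in> S" for q
    proof -
      have "?s * (q + 1) + r - (?s + 0) \<in> S"
        by (rule closed[OF that]) auto
      moreover have "?s * (q + 1) + r - (?s + 0) = ?s * q + r"
        by (simp add: algebra_simps)
      ultimately show ?thesis by (simp only:)
    qed
    have large: "s * s \<le> s * (s + \<bar>c\<bar>) + c" if "1 \<le> s" for s c :: int
    proof -
      have "1 * \<bar>c\<bar> \<le> s * \<bar>c\<bar>"
        by (rule mult_right_mono) (use that in auto)
      then show ?thesis unfolding distrib_left by linarith
    qed
    have up: "?s * (?s + \<bar>c\<bar>) + c \<notin> S" for c
    proof
      assume "?s * (?s + \<bar>c\<bar>) + c \<in> S"
      then have "?s * (?s + \<bar>c\<bar>) + c < ?s * ?s" by (rule bounded)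
      moreover have "?s * ?s \<le> ?s * (?s + \<bar>c\<bar>) + c" by (rule large) simp
      ultimately show False by (meson leD)
    qed
    show "?s * (?s + \<bar>r\<bar>) + r \<notin> S" by (rule up)
    \<comment> \<open>Elements far below belong to S because their mirror images under n, -1-n
      exceed the upper bound.\<close>
    have eq: "?s * (- (?s + \<bar>- 1 - r\<bar>)) + r = -1 - (?s * (?s + \<bar>- 1 - r\<bar>) + (- 1 - r))"
      by (simp add: algebra_simps)
    show "?s * (- (?s + \<bar>- 1 - r\<bar>)) + r \<in> S"
      unfolding eq using up[of "- 1 - r"] sym[of "?s * (?s + \<bar>- 1 - r\<bar>) + (- 1 - r)"] by blast
  qed
  then obtain Q where Q: "?s * q + r \<in> S \<longleftrightarrow> q \<le> Q r" for q r
    by metis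
  have Q_eqI: "Q r = c" if "\<And>q. q \<le> Q r \<longleftrightarrow> q \<le> c" for r c
    using that by (meson order_antisym order_refl)
  have Q_shift: "Q (r + ?s) = Q r - 1" for r
  proof (rule Q_eqI)
    fix q
    have eq: "?s * q + (r + ?s) = ?s * (q + 1) + r" by (simp add: algebra_simps)
    have "q \<le> Q (r + ?s) \<longleftrightarrow> q + 1 \<le> Q r"
      unfolding Q[symmetric] eq by (rule refl)
    then show "q \<le> Q (r + ?s) \<longleftrightarrow> q \<le> Q r - 1" by linarith
  qed
  have Q_neg: "Q (- 1 - r) = - 1 - Q r" for r
  proof (rule Q_eqI)
    fix q
    have eq: "?s * q + (- 1 - r) = - 1 - (?s * (- q) + r)" by (simp add: algebra_simps)
    have "?s * q + (- 1 - r) \<in> S \<longleftrightarrow> ?s * (- q) + r \<notin> S"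
      unfolding eq using sym[of "?s * (- q) + r"] by blast
    then show "q \<le> Q (- 1 - r) \<longleftrightarrow> q \<le> - 1 - Q r"
      unfolding Q by linarith
  qed
  have Q_refl: "Q (2 * int m - r) = - 2 - Q r" for r
    using Q_shift[of "- 1 - r"] Q_neg[of r] by (simp add: algebra_simps)
  have window: "Q r \<le> Q r' + 1" if "r' \<le> r" "r \<le> r' + 2 * int k + 1" for r r'
  proof -
    have "?s * Q r + r \<in> S" by (simp add: Q)
    then have "?s * Q r + r - (?s + (r - r')) \<in> S"
      by (rule closed) (use that in auto)
    moreover have "?s * Q r + r - (?s + (r - r')) = ?s * (Q r - 1) + r'"
      by (simp add: algebra_simps)
    ultimately have "?s * (Q r - 1) + r' \<in> S" by (simp only:)
    then show ?thesis unfolding Q by simp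
  qed
  have start: "Q r \<le> 0" if "0 \<le> r" "r \<le> 2 * int k" for r
  proof (cases "Q 0 < 0")
    case True
    then show ?thesis using window[of 0 r] that by simp
  next
    case False
    \<comment> \<open>The origin of the initial 0 in a profile: comparison with position -1 yields Q
      r \<le> - Q 0.\<close>
    have "Q r \<le> Q (- 1 - 0) + 1" by (rule window) (use that in auto)
    then show ?thesis using False unfolding Q_neg by simp
  qed
  have Qm: "Q (int m) = - 1"
    using Q_refl[of "int m"] by simp
  \<comment> \<open>Position r and its mirror image 2m - r are at most 2k apart, so -2 - Q r \<le> Q
    r + 1; integrality improves Q r \<ge> -3/2 to -1.\<close>
  have near_end: "- 1 \<le> Q r" if "r \<le> int m" "int m \<le> r + int k" for r
    using window[of r "2 * int m - r"] that Q_refl[of r] by simp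
  define g where "g = 0 # map (\<lambda>i. Q (int i) + 1) [0..<m + 1]"
  have nth: "g ! Suc i = Q (int i) + 1" if "i \<le> m" for i
    using that unfolding g_def nth_Cons_Suc by (subst nth_map) (auto simp del: upt_Suc)
  have len: "length g = m + 2"
    by (simp add: g_def)
  have g0: "g ! 0 = 0"
    by (simp add: g_def)
  have "window_bounded (2 * k + 1) g"
    unfolding window_bounded_def
  proof (intro allI impI)
    fix i j assume ij: "i < j" "j < length g" "j \<le> i + (2 * k + 1)"
    then obtain j' where j': "j = Suc j'" "j' \<le> m" using len by (cases j) auto
    show "g ! j \<le> g ! i + 1"
    proof (cases i)
      case 0
      then show ?thesis using start[of "int j'"] ij j' nth g0 by simp
    next
      case (Suc i')
      then show ?thesis using window[of "int i'" "int j'"] ij j' nth by simp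
    qed
  qed
  moreover have "0 \<le> g ! i" if "i \<le> m + 1" "m + 1 \<le> i + k" for i
  proof (cases i)
    case 0
    then show ?thesis using g0 by simp
  next
    case (Suc i')
    then show ?thesis using near_end[of "int i'"] that nth[of i'] by simp
  qed
  ultimately have "g \<in> profiles k (m + 1)"
    using len nth[of m] Qm by (simp add: profiles_def)
  moreover have "bead_set m g = S"
  proof -
    have level: "level m g r = Q r" if "0 \<le> r" "r \<le> 2 * int m" for r
    proof (cases "r \<le> int m")
      case True
      then show ?thesis
        using that nth[of "nat r"] by (simp add: level_def nat_add_distrib)
    next
      case False
      have "nat (2 * int m + 1 - r) = Suc (nat (2 * int m - r))"
        using that by simp
      then show ?thesis
        using that False nth[of "nat (2 * int m - r)"] Q_refl[of r] by (simp add: level_def)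
    qed
    have "n \<in> bead_set m g \<longleftrightarrow> n \<in> S" for n
    proof -
      obtain q r where n: "n = ?s * q + r" "0 \<le> r" "r \<le> 2 * int m"
        by (rule division_by_odd)
      then show ?thesis by (simp add: bead_set_iff level Q)
    qed
    then show ?thesis by blast
  qed
  ultimately show thesis using g0 that by blast
qed

lemma card_symmetric_bead_sets:
  "card (symmetric_bead_sets {2 * m + 1..2 * m + 2 * k + 2}) =
   card {g \<in> profiles k (m + 1). g ! 0 = 0}"
proof -
  have image: "bead_set m ` {g \<in> profiles k (m + 1). g ! 0 = 0} =
      symmetric_bead_sets {2 * m + 1..2 * m + 2 * k + 2}"
  proof (intro equalityI subsetI)
    fix S assume "S \<in> bead_set m ` {g \<in> profiles k (m + 1). g ! 0 = 0}"
    then show "S \<in> symmetric_bead_sets {2 * m + 1..2 * m + 2 * k + 2}"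
      by (elim imageE CollectE conjE) (simp only: bead_set_symmetric)
  next
    fix S assume "S \<in> symmetric_bead_sets {2 * m + 1..2 * m + 2 * k + 2}"
    then show "S \<in> bead_set m ` {g \<in> profiles k (m + 1). g ! 0 = 0}"
      by (rule symmetric_bead_set_realizable) blast
  qed
  show ?thesis
    using card_image[OF inj_on_bead_set, of m k] unfolding image .
qed

theorem theorem2p30:
  fixes m k :: nat
  assumes "0 < m"
  shows "card (self_conjugate_cores {2 * m + 1..2 * m + 2 * k + 2}) =
         card (symmetric_dyck_paths (2 * m + 1) (2 * k + 1))"
proof -
  have "card (self_conjugate_cores {2 * m + 1..2 * m + 2 * k + 2}) =
      card (symmetric_bead_sets {2 * m + 1..2 * m + 2 * k + 2})"
    by (rule card_self_conjugate_cores[of _ "2 * m + 1"]) auto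
  moreover have "int (card (symmetric_dyck_paths (2 * m + 1) (2 * k + 1))) =
      int (card {g \<in> profiles k (m + 1). g ! 0 = 0})"
    unfolding card_profiles by (subst card_symmetric_dyck_paths) (simp_all add: add.commute)
  ultimately show ?thesis
    unfolding card_symmetric_bead_sets by simp
qed

end
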